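(* Fix an integer $N\ge 1$. Let $\phi_{x_n\cdots x_1}$ and $\gamma_{x_n\cdots x_1}$ be two tensors over the same index set $\{x_n,\dots,x_1\}$, and let $\mathcal{F}$ and $\mathcal{G}$ be their $N$-LimTDD representations with the same index order $x_n\prec\cdots\prec x_1$ (built with the same global unique table), with root nodes $r_\mathcal{F},r_\mathcal{G}$ and root weights $w_\mathcal{F},w_\mathcal{G}$. Then the following are equivalent: (1) $\phi$ and $\gamma$ are $\mathcal{XP}_N$-isomorphic; (2) $r_\mathcal{F}=r_\mathcal{G}$ and $w_\mathcal{F}=O\cdot w_\mathcal{G}\cdot g$ for some $O\in\mathcal{XP}_N$ and some $g\in\mathrm{stab}(r_\mathcal{G})$.
   Context: Tensors: maps $\{0,1\}^n\to\mathbb{C}$ over indices $x_n,\dots,x_1$; $\mathrm{vec}(\phi)\in\mathbb{C}^{2^n}$ has $i$-th entry $\phi(i_n,\dots,i_1)$ ($i_n\cdots i_1$ the binary expansion of $i$); an operator $O$ on $n$ qubits acts by $\mathrm{vec}(O\cdot\phi)=O\,\mathrm{vec}(\phi)$. Let $\omega=e^{\pi i/N}$, $X$ the Pauli-$X$ matrix, $P=\mathrm{diag}(1,\omega^2)$. An $XP$-operator of precision $N$ on $n$ qubits is $XP_N(p|\mathbf{x}|\mathbf{z})=\omega^p\bigotimes_i X^{\mathbf{x}[i]}P^{\mathbf{z}[i]}$ ($0\le p<2N$, $\mathbf{x}[i]\in\{0,1\}$, $0\le\mathbf{z}[i]<N$); $\mathcal{XP}_N$ denotes the group they generate, and LimTDD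 edge weights are nonzero complex multiples $\lambda g$ of such operators. Two tensors $\phi,\gamma$ on the same indices are $\mathcal{XP}_N$-isomorphic if $\mathrm{vec}(\phi)=\lambda\, O_n\otimes\cdots\otimes O_1\,\mathrm{vec}(\gamma)$ for some nonzero $\lambda\in\mathbb{C}$ and some $O_n\otimes\cdots\otimes O_1\in\mathcal{XP}_N$. For a node $v$, $\mathrm{stab}(v)=\{O\in\mathcal{XP}_N : O\,\mathrm{vec}(\Phi(v))=\mathrm{vec}(\Phi(v))\}$. LimTDD: a rooted weighted DAG with a terminal node (tensor $1$) and non-terminal nodes $v$ labelled with an index $x_v$, with a low edge to $\mathrm{low}(v)$ and a high edge to $\mathrm{high}(v)$, edges carrying weights; the root has an incoming edge with weight $w_\mathcal{F}$. Semantics: an edge with weight $w$ into node $u$ represents $w\cdot\Phi(u)$; node $v$ represents the tensor whose slice at $x_v=0$ is the tensor of its low edge and at $x_v=1$ is that of its high edge; the LimTDD represents $w_\mathcal{F}\cdot\Phi(r_\mathcal{F})$. Index $x_n$ is at the top. $N$-LimTDD representation: the LimTDD of a tensor obtained by recursively building the LimTDDs of its two slices along the top index and combining them with local normalization, with all nodes kept in one global unique table (a node is identified by its index, its two children and its two edge weights, so identical nodes are shared; nodes are totally ordered by creation time). Local normalization ensures, for every internal node $v$ with children $v_0=\mathrm{low}(v)$, $v_1=\mathrm{high}(v)$ and edge weights $w_0,w_1$: (i) $v_0\le v_1$; (ii) the low-edge weight is $I$ unless it is $0$; (iii) with $W_0=\{g_0^\dagger w_0^\dagger w_1 g_1: g_i\in\mathrm{stab}(v_i)\}$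 and $W_1=\{g_1^\dagger w_1^\dagger w_0 g_0: g_i\in\mathrm{stab}(v_i)\}$, if $v_0<v_1$ the high-edge weight is the smallest element of $W_1$ up to a complex coefficient, and if $v_0=v_1$ it is the smallest element of $W_0\cup W_1$ up to a complex coefficient; the remaining factors (including a factor $X^{b}P^{k}$ on the node's own index) are pushed into the incoming edge weight. Weights $r_1e^{2\pi i\theta_1}XP_N(p_1|\mathbf{x}_1|\mathbf{z}_1)$ and $r_2e^{2\pi i\theta_2}XP_N(p_2|\mathbf{x}_2|\mathbf{z}_2)$ ($r_j\ge 0$) are compared by the lexicographic order of $(\mathbf{x}_j|\mathbf{z}_j|r_j|\theta_j|p_j)$.
   Formalization: In (2), w_F = c·O·w_G·g with a nonzero complex c (without c, φ=2γ is a counterexample); in the normalization, † on weights is the inverse, W_0 is used when edge order is kept and W_1 when swapped, and the free coefficient is a power of ω². *)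

theory Defs
  imports
    "HOL-Algebra.Generated_Groups"
    "Jordan_Normal_Form.Matrix"
begin

text \<open>
  A tensor over \<open>x\<^sub>n, \<dots>, x\<^sub>1\<close> is a function on bit lists; only its values on lists of length \<open>n\<close>
  matter.  The head of a list is the value of the top index \<open>x\<^sub>n\<close>; likewise the head of the
  lists \<open>xs\<close>, \<open>zs\<close> describing an operator belongs to the qubit of \<open>x\<^sub>n\<close>.
\<close>

type_synonym tensor = "bool list \<Rightarrow> complex"

definition tvec :: "nat \<Rightarrow> tensor \<Rightarrow> complex vec" where
  "tvec n \<phi> = vec (2 ^ n) (\<lambda>i. \<phi> (map (bit i) (rev [0..<n])))"

definition act :: "nat \<Rightarrow> complex mat \<Rightarrow> tensor \<Rightarrow> tensor" where
  "act n A \<phi> = (\<lambda>xs. (A *\<^sub>v tvec n \<phi>) $ horner_sum of_bool 2 (rev xs))"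

definition slice :: "bool \<Rightarrow> tensor \<Rightarrow> tensor" where
  "slice b \<phi> = (\<lambda>xs. \<phi> (b # xs))"

section \<open>XP operators\<close>

definition kron :: "complex mat \<Rightarrow> complex mat \<Rightarrow> complex mat" where
  "kron A B = mat (dim_row A * dim_row B) (dim_col A * dim_col B)
     (\<lambda>(i, j). A $$ (i div dim_row B, j div dim_col B) * B $$ (i mod dim_row B, j mod dim_col B))"

fun kron_list :: "complex mat list \<Rightarrow> complex mat" where
  "kron_list [] = 1\<^sub>m 1"
| "kron_list (A # As) = kron A (kron_list As)"

definition xp_omega :: "nat \<Rightarrow> complex" where
  "xp_omega N = exp (\<i> * of_real pi / of_nat N)"

definition pauli_X :: "complex mat" where
  "pauli_X = mat_of_rows_list 2 [[0, 1], [1, 0]]"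

definition phase_P :: "nat \<Rightarrow> complex mat" where
  "phase_P N = mat_of_rows_list 2 [[1, 0], [0, xp_omega N ^ 2]]"

definition xp_op :: "nat \<Rightarrow> nat \<Rightarrow> nat list \<Rightarrow> nat list \<Rightarrow> complex mat" where
  "xp_op N p xs zs =
     xp_omega N ^ p \<cdot>\<^sub>m kron_list (map2 (\<lambda>x z. pauli_X ^\<^sub>m x * phase_P N ^\<^sub>m z) xs zs)"

definition xp_params :: "nat \<Rightarrow> nat \<Rightarrow> nat \<Rightarrow> nat list \<Rightarrow> nat list \<Rightarrow> bool" where
  "xp_params N n p xs zs \<longleftrightarrow>
     p < 2 * N \<and> length xs = n \<and> set xs \<subseteq> {0, 1} \<and> length zs = n \<and> (\<forall>z \<in> set zs. z < N)"

abbreviation op_ring :: "nat \<Rightarrow> complex mat ring" where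
  "op_ring n \<equiv> ring_mat TYPE(complex) (2 ^ n) ()"

definition xp_group :: "nat \<Rightarrow> nat \<Rightarrow> complex mat set" where
  "xp_group N n = generate (op_ring n) {xp_op N p xs zs | p xs zs. xp_params N n p xs zs}"

definition xp_isomorphic :: "nat \<Rightarrow> nat \<Rightarrow> tensor \<Rightarrow> tensor \<Rightarrow> bool" where
  "xp_isomorphic N n \<phi> \<gamma> \<longleftrightarrow>
     (\<exists>c A. c \<noteq> 0 \<and> A \<in> xp_group N n \<and> tvec n \<phi> = c \<cdot>\<^sub>v (A *\<^sub>v tvec n \<gamma>))"

section \<open>Order on edge weights\<close>

text \<open>
  The phases \<open>e\<^sup>2\<^sup>\<pi>\<^sup>i\<^sup>\<theta>\<close> and \<open>\<omega>\<^sup>p\<close> overlap.  The bound \<open>\<theta> < 1/(2N)\<close> selects the lexicographically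
  least description of a nonzero weight, which makes the tuple unique.
\<close>

type_synonym weight_key = "nat list \<times> nat list \<times> real \<times> real \<times> nat"

definition has_key :: "nat \<Rightarrow> nat \<Rightarrow> complex mat \<Rightarrow> weight_key \<Rightarrow> bool" where
  "has_key N n w = (\<lambda>(xs, zs, r, \<theta>, p).
     xp_params N n p xs zs \<and> 0 \<le> r \<and> 0 \<le> \<theta> \<and> \<theta> < 1 / (2 * real N) \<and>
     w = (of_real r * exp (2 * of_real pi * \<i> * of_real \<theta>)) \<cdot>\<^sub>m xp_op N p xs zs)"

definition key_less :: "weight_key rel" where
  "key_less = lexord less_than <*lex*> lexord less_than <*lex*>
     {(r, s). r < s} <*lex*> {(r, s). r < s} <*lex*> less_than"

definition weight_less :: "nat \<Rightarrow> nat \<Rightarrow> complex mat \<Rightarrow> complex mat \<Rightarrow> bool" where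
  "weight_less N n w w' \<longleftrightarrow> (\<exists>k k'. has_key N n w k \<and> has_key N n w' k' \<and> (k, k') \<in> key_less)"

definition smallest_weight :: "nat \<Rightarrow> nat \<Rightarrow> complex mat set \<Rightarrow> complex mat \<Rightarrow> bool" where
  "smallest_weight N n W w \<longleftrightarrow> w \<in> W \<and> (\<forall>w' \<in> W. w' = w \<or> weight_less N n w w')"

section \<open>Nodes and the unique table\<close>

text \<open>
  Nodes are numbered by creation time: \<open>0\<close> is the terminal node, and \<open>v > 0\<close> is entry \<open>v - 1\<close> of
  the table.  A node over index \<open>x\<^sub>k\<close> has \<open>node_index = k\<close>, and its edge weights are operators on
  the \<open>k - 1\<close> qubits below it.
\<close>

datatype node = Node
  (node_index: nat)
  (low_weight: "complex mat") (low: nat)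
  (high_weight: "complex mat") (high: nat)

type_synonym table = "node list"
type_synonym edge = "complex mat \<times> nat"

text \<open>
  \<open>node_tensor T n v\<close> is \<open>\<Phi>(v)\<close> as a tensor over \<open>x\<^sub>n, \<dots>, x\<^sub>1\<close>, constant in the indices that do not
  occur in \<open>v\<close>.  This convention only matters for the terminal node as the target of a
  zero edge.
\<close>

primrec node_tensor :: "table \<Rightarrow> nat \<Rightarrow> nat \<Rightarrow> tensor" where
  "node_tensor T 0 v = (\<lambda>xs. 1)"
| "node_tensor T (Suc n) v = (\<lambda>xs.
     let u = T ! (v - 1) in
     if v \<noteq> 0 \<and> node_index u = Suc n
     then if hd xs
          then act n (high_weight u) (node_tensor T n (high u)) (tl xs)
          else act n (low_weight u) (node_tensor T n (low u)) (tl xs)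
     else node_tensor T n v (tl xs))"

definition stab :: "nat \<Rightarrow> table \<Rightarrow> nat \<Rightarrow> nat \<Rightarrow> complex mat set" where
  "stab N T n v =
     {A \<in> xp_group N n. A *\<^sub>v tvec n (node_tensor T n v) = tvec n (node_tensor T n v)}"

definition intern :: "table \<Rightarrow> node \<Rightarrow> table \<Rightarrow> nat \<Rightarrow> bool" where
  "intern T u T' v \<longleftrightarrow>
     T' = (if u \<in> set T then T else T @ [u]) \<and> 0 < v \<and> v \<le> length T' \<and> T' ! (v - 1) = u"

section \<open>Local normalization\<close>

text \<open>
  Inverses of weights are taken in the matrix ring: the inverse of \<open>\<lambda>g\<close> is \<open>\<lambda>\<^sup>-\<^sup>1 g\<^sup>\<dagger>\<close>, which agrees
  with \<open>(\<lambda>g)\<^sup>\<dagger>\<close> up to a complex coefficient.  The factor \<open>\<omega>\<^sup>-\<^sup>2\<^sup>k\<close> is the coefficient that a \<open>P\<^sup>k\<close> on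
  the node's own index compensates in the incoming weight.
\<close>

definition quot_weight ::
  "nat \<Rightarrow> nat \<Rightarrow> nat \<Rightarrow> complex mat \<Rightarrow> complex mat \<Rightarrow> complex mat \<Rightarrow> complex mat \<Rightarrow> complex mat" where
  "quot_weight N n k g w w' g' =
     inverse (xp_omega N ^ (2 * k)) \<cdot>\<^sub>m (m_inv (op_ring n) g * m_inv (op_ring n) w * w' * g')"

definition quot_weights :: "nat \<Rightarrow> table \<Rightarrow> nat \<Rightarrow> edge \<Rightarrow> edge \<Rightarrow> complex mat set" where
  "quot_weights N T n = (\<lambda>(w, v) (w', v').
     {quot_weight N n k g w w' g' | k g g'. k < N \<and> g \<in> stab N T n v \<and> g' \<in> stab N T n v'})"

definition high_candidates :: "nat \<Rightarrow> table \<Rightarrow> nat \<Rightarrow> edge \<Rightarrow> edge \<Rightarrow> complex mat set" where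
  "high_candidates N T n e\<^sub>0 e\<^sub>1 =
     (if snd e\<^sub>0 < snd e\<^sub>1 then quot_weights N T n e\<^sub>0 e\<^sub>1
      else if snd e\<^sub>1 < snd e\<^sub>0 then quot_weights N T n e\<^sub>1 e\<^sub>0
      else quot_weights N T n e\<^sub>0 e\<^sub>1 \<union> quot_weights N T n e\<^sub>1 e\<^sub>0)"

text \<open>
  A node with exactly one nonzero slice.  Zero edges point to the terminal node, the least of all
  nodes, so the zero edge has to be the low one unless both children are the terminal node, in
  which case the low weight is \<open>I\<close>.
\<close>

definition half_node :: "nat \<Rightarrow> nat \<Rightarrow> node" where
  "half_node n v =
     (if v = 0 then Node (Suc n) (1\<^sub>m (2 ^ n)) 0 (0\<^sub>m (2 ^ n) (2 ^ n)) 0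
      else Node (Suc n) (0\<^sub>m (2 ^ n) (2 ^ n)) 0 (1\<^sub>m (2 ^ n)) v)"

text \<open>
  \<open>normalize N T n e\<^sub>0 e\<^sub>1 w u\<close>: the node over \<open>x\<^sub>n\<^sub>+\<^sub>1\<close> with low edge \<open>e\<^sub>0\<close> and high edge \<open>e\<^sub>1\<close> is
  replaced by the node \<open>u\<close> with incoming weight \<open>w\<close>.  The rules fix \<open>w\<close> only up to the choice of
  \<open>k\<close>, \<open>g\<^sub>0\<close>, \<open>g\<^sub>1\<close> attaining the smallest high weight.
\<close>

inductive normalize :: "nat \<Rightarrow> table \<Rightarrow> nat \<Rightarrow> edge \<Rightarrow> edge \<Rightarrow> complex mat \<Rightarrow> node \<Rightarrow> bool"
  for N :: nat and T :: table and n :: nat where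
  keep: "\<lbrakk>w\<^sub>0 \<noteq> 0\<^sub>m (2 ^ n) (2 ^ n); w\<^sub>1 \<noteq> 0\<^sub>m (2 ^ n) (2 ^ n); v\<^sub>0 \<le> v\<^sub>1;
      k < N; g\<^sub>0 \<in> stab N T n v\<^sub>0; g\<^sub>1 \<in> stab N T n v\<^sub>1; h = quot_weight N n k g\<^sub>0 w\<^sub>0 w\<^sub>1 g\<^sub>1;
      smallest_weight N n (high_candidates N T n (w\<^sub>0, v\<^sub>0) (w\<^sub>1, v\<^sub>1)) h\<rbrakk>
    \<Longrightarrow> normalize N T n (w\<^sub>0, v\<^sub>0) (w\<^sub>1, v\<^sub>1)
          (kron (phase_P N ^\<^sub>m k) (w\<^sub>0 * g\<^sub>0)) (Node (Suc n) (1\<^sub>m (2 ^ n)) v\<^sub>0 h v\<^sub>1)"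
| swap: "\<lbrakk>w\<^sub>0 \<noteq> 0\<^sub>m (2 ^ n) (2 ^ n); w\<^sub>1 \<noteq> 0\<^sub>m (2 ^ n) (2 ^ n); v\<^sub>1 \<le> v\<^sub>0;
      k < N; g\<^sub>0 \<in> stab N T n v\<^sub>0; g\<^sub>1 \<in> stab N T n v\<^sub>1; h = quot_weight N n k g\<^sub>1 w\<^sub>1 w\<^sub>0 g\<^sub>0;
      smallest_weight N n (high_candidates N T n (w\<^sub>0, v\<^sub>0) (w\<^sub>1, v\<^sub>1)) h\<rbrakk>
    \<Longrightarrow> normalize N T n (w\<^sub>0, v\<^sub>0) (w\<^sub>1, v\<^sub>1)
          (kron (pauli_X * phase_P N ^\<^sub>m k) (w\<^sub>1 * g\<^sub>1)) (Node (Suc n) (1\<^sub>m (2 ^ n)) v\<^sub>1 h v\<^sub>0)"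
| high_zero: "\<lbrakk>w\<^sub>0 \<noteq> 0\<^sub>m (2 ^ n) (2 ^ n); w\<^sub>1 = 0\<^sub>m (2 ^ n) (2 ^ n)\<rbrakk>
    \<Longrightarrow> normalize N T n (w\<^sub>0, v\<^sub>0) (w\<^sub>1, v\<^sub>1)
          (kron (pauli_X ^\<^sub>m (if v\<^sub>0 = 0 then 0 else 1)) w\<^sub>0) (half_node n v\<^sub>0)"
| low_zero: "\<lbrakk>w\<^sub>0 = 0\<^sub>m (2 ^ n) (2 ^ n); w\<^sub>1 \<noteq> 0\<^sub>m (2 ^ n) (2 ^ n)\<rbrakk>
    \<Longrightarrow> normalize N T n (w\<^sub>0, v\<^sub>0) (w\<^sub>1, v\<^sub>1)
          (kron (pauli_X ^\<^sub>m (if v\<^sub>1 = 0 then 1 else 0)) w\<^sub>1) (half_node n v\<^sub>1)"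

section \<open>Building LimTDDs\<close>

text \<open>
  \<open>build N n \<phi> T T' w v\<close>: starting from the unique table \<open>T\<close>, building the LimTDD of \<open>\<phi>\<close> ends with
  the table \<open>T'\<close>, the root node \<open>v\<close> and the root weight \<open>w\<close>.
\<close>

inductive build :: "nat \<Rightarrow> nat \<Rightarrow> tensor \<Rightarrow> table \<Rightarrow> table \<Rightarrow> complex mat \<Rightarrow> nat \<Rightarrow> bool"
  for N :: nat where
  zero: "tvec n \<phi> = 0\<^sub>v (2 ^ n) \<Longrightarrow> build N n \<phi> T T (0\<^sub>m (2 ^ n) (2 ^ n)) 0"
| terminal: "\<phi> [] \<noteq> 0 \<Longrightarrow> build N 0 \<phi> T T (\<phi> [] \<cdot>\<^sub>m 1\<^sub>m 1) 0"
| branch: "\<lbrakk>tvec (Suc n) \<phi> \<noteq> 0\<^sub>v (2 ^ Suc n);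
      build N n (slice False \<phi>) T T\<^sub>0 w\<^sub>0 v\<^sub>0; build N n (slice True \<phi>) T\<^sub>0 T\<^sub>1 w\<^sub>1 v\<^sub>1;
      normalize N T\<^sub>1 n (w\<^sub>0, v\<^sub>0) (w\<^sub>1, v\<^sub>1) w u; intern T\<^sub>1 u T\<^sub>2 v\<rbrakk>
    \<Longrightarrow> build N (Suc n) \<phi> T T\<^sub>2 w v"

definition table_step :: "nat \<Rightarrow> table \<Rightarrow> table \<Rightarrow> bool" where
  "table_step N T T' \<longleftrightarrow> (\<exists>n \<phi> w v. build N n \<phi> T T' w v)"

text \<open>
  \<open>(w, r)\<close> is the root edge of the LimTDD of \<open>\<phi>\<close>, built at some point of a history of the global
  table, which starts empty and has grown to \<open>T\<close>.
\<close>

definition limtdd_rep :: "nat \<Rightarrow> table \<Rightarrow> nat \<Rightarrow> tensor \<Rightarrow> complex mat \<Rightarrow> nat \<Rightarrow> bool" where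
  "limtdd_rep N T n \<phi> w r \<longleftrightarrow>
     (\<exists>T\<^sub>0 T\<^sub>1. (table_step N)\<^sup>*\<^sup>* [] T\<^sub>0 \<and> build N n \<phi> T\<^sub>0 T\<^sub>1 w r \<and> (table_step N)\<^sup>*\<^sup>* T\<^sub>1 T)"

end

theory Submission
  imports Defs
begin

text \<open>
  Canonicity is proved by induction on the number of indices.  An XP isomorphism acts on the top
  index as \<open>X\<^sup>b P\<^sup>k\<close>, so it matches the slices of \<open>\<phi>\<close> with those of \<open>\<gamma>\<close>, possibly swapped, and the
  matched slices are built with the same nodes \<open>v\<^sub>0\<close>, \<open>v\<^sub>1\<close>.  If \<open>w \<Phi>(v) = M u \<Phi>(v)\<close> for weights \<open>w\<close>, \<open>u\<close>
  and an invertible weight \<open>M\<close>, then \<open>(M u)\<^sup>-\<^sup>1 w\<close> fixes the nonzero tensor \<open>\<Phi>(v)\<close>.  Every eigenvalue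
  of an XP operator is a power of \<open>\<omega>\<close>, so this quotient is itself an XP operator and lies in
  \<open>stab(v)\<close>.  Hence both tensors have the same set of candidate high weights; the minimum of that
  set is unique, which makes the two top nodes equal.  The same quotient argument at the root gives
  the relation between the root weights.
\<close>

text \<open>The two tensors may be built at different times, and the table grows in between, so
  everything is compared in the final table. This is sound because children are older than their
  parents: later entries change neither the tensor nor the stabilizer of an existing node.
  Distinctness of the table then turns equal entries into equal node numbers. A factor X on the top
  index exchanges the slices. The candidates for the high weight do not notice this: which quotient
  is formed depends on the node numbers alone, and for equal children both quotients are candidates.
  A factor P^k changes the relative phase of the slices by \<omega>^(2k), which is absorbed because
  the candidates range over all k < N. A scalar common to both slices cancels in the quotient; it is
  therefore merged with the operator into one weight M. A zero slice has no invertible weight, so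
  quotients make no sense for it. Such nodes are treated apart: they are determined by the number of
  the nonzero child, once it is known that M preserves which slices vanish.\<close>

section \<open>Kronecker products with monomial two-by-two matrices\<close>

text \<open>This is X^b diag(1, c). With an arbitrary c the identity, X, the powers of P and their
  products lie in one family, closed under multiplication up to a scalar.\<close>

definition phase_mat :: "bool \<Rightarrow> complex \<Rightarrow> complex mat" where
  "phase_mat b c = mat_of_rows_list 2 (if b then [[0, c], [1, 0]] else [[1, 0], [0, c]])"

lemma phase_mat_carrier [simp]: "phase_mat b c \<in> carrier_mat 2 2"
  by (auto simp: phase_mat_def mat_of_rows_list_def)

lemma dim_phase_mat [simp]: "dim_row (phase_mat b c) = 2" "dim_col (phase_mat b c) = 2"
  by (rule carrier_matD[OF phase_mat_carrier])+

lemma phase_mat_index [simp]: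
  "phase_mat b c $$ (0, 0) = (if b then 0 else 1)" "phase_mat b c $$ (0, Suc 0) = (if b then c else 0)"
  "phase_mat b c $$ (Suc 0, 0) = (if b then 1 else 0)" "phase_mat b c $$ (Suc 0, Suc 0) = (if b then 0 else c)"
  by (simp_all add: phase_mat_def mat_of_rows_list_def)

lemma eq_mat_two:
  assumes "A \<in> carrier_mat 2 2" "B \<in> carrier_mat 2 2"
    "A $$ (0, 0) = B $$ (0, 0)" "A $$ (0, Suc 0) = B $$ (0, Suc 0)"
    "A $$ (Suc 0, 0) = B $$ (Suc 0, 0)" "A $$ (Suc 0, Suc 0) = B $$ (Suc 0, Suc 0)"
  shows "A = B"
  using assms by (intro eq_matI) (auto simp: less_2_cases_iff)

lemma mult_mat_two_index:
  fixes A B :: "complex mat"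
  assumes "A \<in> carrier_mat 2 2" "B \<in> carrier_mat 2 2" "i < 2" "j < 2"
  shows "(A * B) $$ (i, j) = A $$ (i, 0) * B $$ (0, j) + A $$ (i, Suc 0) * B $$ (Suc 0, j)"
proof -
  have "{0..<2::nat} = {0, Suc 0}" by auto
  then show ?thesis using assms by (simp add: scalar_prod_def)
qed

text \<open>Moving a phase past X costs a scalar: diag(1, c) X = c X diag(1, 1/c).\<close>

lemma phase_mat_mult:
  assumes "c \<noteq> 0"
  shows "phase_mat b c * phase_mat b' c' =
    (if b' then c \<cdot>\<^sub>m phase_mat (\<not> b) (c' / c) else phase_mat b (c * c'))"
proof (rule eq_mat_two)
  show "phase_mat b c * phase_mat b' c' \<in> carrier_mat 2 2"
    by (rule mult_carrier_mat[OF phase_mat_carrier phase_mat_carrier])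
qed (use assms in \<open>simp_all add: mult_mat_two_index del: index_mult_mat(1)\<close>)

lemma phase_P_pow: "phase_P N ^\<^sub>m k = phase_mat False (xp_omega N ^ (2 * k))"
proof (induction k)
  case 0
  show ?case by (rule eq_mat_two) (auto simp: phase_P_def mat_of_rows_list_def)
next
  case (Suc k)
  have "phase_P N = phase_mat False (xp_omega N ^ 2)" by (simp add: phase_P_def phase_mat_def)
  then show ?case using Suc
    by (simp add: phase_mat_mult xp_omega_def power_add power2_eq_square algebra_simps)
qed

lemma pauli_X_eq: "pauli_X = phase_mat True 1"
  by (simp add: pauli_X_def phase_mat_def)

lemma pauli_X_pow: "b < 2 \<Longrightarrow> pauli_X ^\<^sub>m b = phase_mat (b = 1) 1"
proof -
  assume "b < 2"
  then consider "b = 0" | "b = 1" by linarith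
  then show ?thesis
    by cases (auto simp: pauli_X_eq intro!: eq_mat_two)
qed

text \<open>With a left factor of size 2 the Kronecker product is a 2 by 2 block matrix, so block
  calculus replaces index arithmetic with \<open>div\<close> and \<open>mod\<close>.\<close>

lemma kron_four_block:
  assumes A: "A \<in> carrier_mat 2 2" and B: "B \<in> carrier_mat m m"
  shows "kron A B = four_block_mat (A $$ (0, 0) \<cdot>\<^sub>m B) (A $$ (0, Suc 0) \<cdot>\<^sub>m B)
                      (A $$ (Suc 0, 0) \<cdot>\<^sub>m B) (A $$ (Suc 0, Suc 0) \<cdot>\<^sub>m B)"
    (is "_ = ?R")
proof (rule eq_matI)
  have div: "i div m = (if i < m then 0 else Suc 0)" and mod: "i mod m = (if i < m then i else i - m)"
    if "i < m + m" for i
    using that by (auto simp: div_if mod_if)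
  show "kron A B $$ (i, j) = ?R $$ (i, j)" if "i < dim_row ?R" "j < dim_col ?R" for i j
    using that A B div mod by (auto simp: kron_def mult_2)
qed (use A B in \<open>auto simp: kron_def\<close>)

lemma kron_carrier [simp]:
  assumes "A \<in> carrier_mat 2 2" "B \<in> carrier_mat (2 ^ n) (2 ^ n)"
  shows "kron A B \<in> carrier_mat (2 ^ Suc n) (2 ^ Suc n)"
  using assms by (auto simp: kron_def)

lemma smult_smult_mat: "a \<cdot>\<^sub>m (b \<cdot>\<^sub>m A) = (a * b :: complex) \<cdot>\<^sub>m A"
  by (rule eq_matI) (simp_all add: mult.assoc)

lemma one_smult_mat: "(1 :: complex) \<cdot>\<^sub>m A = A"
  by (rule eq_matI) simp_all

lemma smult_mat_mult_vec: "dim_vec v = dim_col A \<Longrightarrow> (c \<cdot>\<^sub>m A) *\<^sub>v v = (c :: complex) \<cdot>\<^sub>v (A *\<^sub>v v)"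
  by (rule eq_vecI) simp_all

lemma kron_mult:
  assumes "A \<in> carrier_mat 2 2" "B \<in> carrier_mat m m" "C \<in> carrier_mat 2 2" "D \<in> carrier_mat m m"
  shows "kron A B * kron C D = kron (A * C) (B * D)"
proof -
  have AC: "A * C \<in> carrier_mat 2 2" and BD: "B * D \<in> carrier_mat m m" using assms by auto
  have ent: "(A * C) $$ (i, j) = A $$ (i, 0) * C $$ (0, j) + A $$ (i, Suc 0) * C $$ (Suc 0, j)"
    if "i < 2" "j < 2" for i j
    using assms that by (rule_tac mult_mat_two_index)
  have prod: "(a \<cdot>\<^sub>m B) * (c \<cdot>\<^sub>m D) = (a * c) \<cdot>\<^sub>m (B * D)" for a c
    using assms by (auto simp: mult_smult_distrib[of _ m m] mult_smult_assoc_mat[of _ m m] smult_smult_mat)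
  show ?thesis
    unfolding kron_four_block[OF assms(1,2)] kron_four_block[OF assms(3,4)] kron_four_block[OF AC BD]
    by (subst mult_four_block_mat[of _ m m _ m _ m _ _ m _ m])
      (use assms BD in \<open>auto simp: prod ent add_smult_distrib_right_mat[of _ m m] simp del: index_mult_mat(1)\<close>)
qed

lemma kron_smult:
  assumes "A \<in> carrier_mat 2 2" "B \<in> carrier_mat m m"
  shows "kron (c \<cdot>\<^sub>m A) B = kron A (c \<cdot>\<^sub>m B)" "c \<cdot>\<^sub>m kron A B = kron A (c \<cdot>\<^sub>m B)"
proof -
  have cA: "c \<cdot>\<^sub>m A \<in> carrier_mat 2 2" and cB: "c \<cdot>\<^sub>m B \<in> carrier_mat m m" using assms by auto
  have i: "0 < dim_row A" "0 < dim_col A" "Suc 0 < dim_row A" "Suc 0 < dim_col A" using assms(1) by auto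
  note f = kron_four_block[OF assms] kron_four_block[OF cA assms(2)] kron_four_block[OF assms(1) cB]
  show "kron (c \<cdot>\<^sub>m A) B = kron A (c \<cdot>\<^sub>m B)"
    unfolding f using i by (simp add: smult_smult_mat mult.commute)
  show "c \<cdot>\<^sub>m kron A B = kron A (c \<cdot>\<^sub>m B)"
    unfolding f by (subst smult_four_block_mat[of _ m m _ m _ m])
      (use assms(2) in \<open>simp_all add: smult_smult_mat mult.commute\<close>)
qed

text \<open>The two halves of the vector are the slices along the top index: the phase scales the
  slice at 1, and then X exchanges the halves.\<close>

lemma kron_phase_mat_vec:
  assumes "B \<in> carrier_mat m m" "u \<in> carrier_vec m" "v \<in> carrier_vec m"
  shows "kron (phase_mat b c) B *\<^sub>v (u @\<^sub>v v) =
    (if b then (c \<cdot>\<^sub>v (B *\<^sub>v v)) @\<^sub>v (B *\<^sub>v u) else (B *\<^sub>v u) @\<^sub>v (c \<cdot>\<^sub>v (B *\<^sub>v v)))"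
proof -
  have s: "(c \<cdot>\<^sub>m B) *\<^sub>v x = c \<cdot>\<^sub>v (B *\<^sub>v x)" if "x \<in> carrier_vec m" for c x
    using that assms by (intro smult_mat_mult_vec) simp
  have z: "0 \<cdot>\<^sub>v (B *\<^sub>v x) = 0\<^sub>v m" for x using assms by auto
  have c: "B *\<^sub>v x \<in> carrier_vec m" for x using assms(1) by (intro carrier_vecI) simp
  show ?thesis
    unfolding kron_four_block[OF phase_mat_carrier assms(1)]
    by (subst four_block_mat_mult_vec[of _ m m _ m _ m])
      (use assms c in \<open>simp_all add: s z\<close>)
qed


lemma kron_phase_mat_index:
  assumes "D \<in> carrier_mat m m" "i < m" "j < m"
  shows "kron (phase_mat b c) D $$ (i, j) = (if b then 0 else D $$ (i, j))"
    "kron (phase_mat b c) D $$ (i + m, j) = (if b then D $$ (i, j) else 0)"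
    "kron (phase_mat b c) D $$ (i, j + m) = (if b then c * D $$ (i, j) else 0)"
    "kron (phase_mat b c) D $$ (i + m, j + m) = (if b then 0 else c * D $$ (i, j))"
  using assms(2,3) carrier_matD[OF assms(1)]
  by (simp_all add: kron_four_block[OF phase_mat_carrier assms(1)])

text \<open>In the first block column exactly one block is zero. Its position reveals
  \<open>b\<close>, the other block is \<open>B\<close> itself, and comparing a nonzero entry of
  \<open>B\<close> with the second block column reveals \<open>c\<close>.\<close>

lemma kron_phase_mat_inject:
  assumes B: "B \<in> carrier_mat m m" "B' \<in> carrier_mat m m" and nz: "B \<noteq> 0\<^sub>m m m"
    and eq: "kron (phase_mat b c) B = kron (phase_mat b' c') B'"
  shows "b = b'" "B = B'" "c = c'"
proof -
  have "\<exists>i < m. \<exists>j < m. B $$ (i, j) \<noteq> 0"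
  proof (rule ccontr)
    assume "\<not> ?thesis"
    then have "B = 0\<^sub>m m m" using B(1) by (intro eq_matI) auto
    with nz show False by simp
  qed
  then obtain i j where ij: "i < m" "j < m" "B $$ (i, j) \<noteq> 0" by blast
  note e = kron_phase_mat_index[OF B(1), of _ _ b c] kron_phase_mat_index[OF B(2), of _ _ b' c', folded eq]
  show b: "b = b'"
    using e(1,2,5,6)[OF ij(1,2)] ij(3) by (cases b; cases b') simp_all
  show BB: "B = B'"
  proof (rule eq_matI)
    fix i j assume "i < dim_row B'" "j < dim_col B'"
    then have "i < m" "j < m" using B by auto
    then show "B $$ (i, j) = B' $$ (i, j)"
      using e(1,2,5,6)[of i j] b by (cases b') simp_all
  qed (use B in auto)
  show "c = c'"
    using e(3,4,7,8)[OF ij(1,2)] ij(3) b BB by (cases b') simp_all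
qed

lemma one_mat_kron: "1\<^sub>m (2 ^ Suc n) = kron (phase_mat False 1) (1\<^sub>m (2 ^ n))"
  by (subst kron_four_block[of _ _ "2 ^ n"]) (auto intro!: eq_matI)

section \<open>XP operators and edge weights\<close>

definition phases :: "nat \<Rightarrow> complex set" where
  "phases N = range (\<lambda>p. xp_omega N ^ p)"

text \<open>The relative phases between two slices that a power of P can produce.\<close>

definition even_phases :: "nat \<Rightarrow> complex set" where
  "even_phases N = range (\<lambda>k. xp_omega N ^ (2 * k))"

section \<open>Arithmetic of the powers of \<omega>\<close>

lemma xp_omega_pow: "xp_omega N ^ p = cis (real p * (pi / real N))"
proof -
  have "xp_omega N = cis (pi / real N)" by (simp add: xp_omega_def cis_conv_exp)
  then show ?thesis by (simp add: Complex.DeMoivre)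
qed

lemma xp_omega_nonzero [simp]: "xp_omega N \<noteq> 0"
  by (simp add: xp_omega_def)

lemma xp_omega_pow_N: "N \<ge> 1 \<Longrightarrow> xp_omega N ^ N = -1"
  by (simp add: xp_omega_pow)

lemma xp_omega_pow_2N: "N \<ge> 1 \<Longrightarrow> xp_omega N ^ (2 * N) = 1"
  by (subst mult.commute) (simp add: power_mult xp_omega_pow_N)

lemma xp_omega_pow_mod:
  assumes "N \<ge> 1"
  shows "xp_omega N ^ (p mod (2 * N)) = xp_omega N ^ p" "xp_omega N ^ (2 * (k mod N)) = xp_omega N ^ (2 * k)"
proof -
  have *: "xp_omega N ^ (p mod (2 * N)) = xp_omega N ^ p" for p
  proof -
    have "xp_omega N ^ p = xp_omega N ^ (2 * N * (p div (2 * N)) + p mod (2 * N))" by simp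
    also have "\<dots> = xp_omega N ^ (p mod (2 * N))"
      unfolding power_add power_mult[of _ "2 * N"] xp_omega_pow_2N[OF assms] by simp
    finally show ?thesis by simp
  qed
  show "xp_omega N ^ (p mod (2 * N)) = xp_omega N ^ p" by (rule *)
  show "xp_omega N ^ (2 * (k mod N)) = xp_omega N ^ (2 * k)"
    using *[of "2 * k"] by (simp only: mult_mod_right)
qed

lemma phases_eq:
  assumes "N \<ge> 1"
  shows "phases N = {xp_omega N ^ p | p. p < 2 * N}"
proof -
  have "xp_omega N ^ p = xp_omega N ^ (p mod (2 * N)) \<and> p mod (2 * N) < 2 * N" for p
    using assms xp_omega_pow_mod(1)[OF assms, of p] by simp
  then show ?thesis unfolding phases_def by blast
qed

lemma even_phases_eq:
  assumes "N \<ge> 1"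
  shows "even_phases N = {xp_omega N ^ (2 * k) | k. k < N}"
proof -
  have "xp_omega N ^ (2 * k) = xp_omega N ^ (2 * (k mod N)) \<and> k mod N < N" for k
    using assms xp_omega_pow_mod(2)[OF assms, of k] by simp
  then show ?thesis unfolding even_phases_def by blast
qed

text \<open>Exponents are natural numbers, so 2N - 1 stands in for -1. As a factor of the exponent
  it keeps even exponents even.\<close>

lemma inverse_xp_omega_pow:
  assumes "N \<ge> 1"
  shows "inverse (xp_omega N ^ p) = xp_omega N ^ (p * (2 * N - 1))"
proof (rule inverse_unique)
  have "xp_omega N ^ p * xp_omega N ^ (p * (2 * N - 1)) = xp_omega N ^ (p * (1 + (2 * N - 1)))"
    by (simp add: power_add distrib_left)
  also have "1 + (2 * N - 1) = 2 * N" using assms by simp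
  also have "xp_omega N ^ (p * (2 * N)) = 1"
    using xp_omega_pow_2N[OF assms] by (simp add: mult.commute[of p] power_mult)
  finally show "xp_omega N ^ p * xp_omega N ^ (p * (2 * N - 1)) = 1" .
qed

lemma even_phases_nonzero: "c \<in> even_phases N \<Longrightarrow> c \<noteq> 0"
  by (auto simp: even_phases_def)

lemma even_phases_one [simp]: "1 \<in> even_phases N"
  unfolding even_phases_def by (rule range_eqI[of _ _ 0]) simp

lemma even_phases_mult:
  assumes "c \<in> even_phases N" "d \<in> even_phases N"
  shows "c * d \<in> even_phases N"
proof -
  obtain k l where "c = xp_omega N ^ (2 * k)" "d = xp_omega N ^ (2 * l)"
    using assms by (auto simp: even_phases_def)
  then have "c * d = xp_omega N ^ (2 * (k + l))" by (simp add: power_add distrib_left)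
  then show ?thesis unfolding even_phases_def by blast
qed

lemma even_phases_inverse:
  assumes "N \<ge> 1" "c \<in> even_phases N"
  shows "inverse c \<in> even_phases N"
proof -
  obtain k where "c = xp_omega N ^ (2 * k)" using assms by (auto simp: even_phases_def)
  then have "inverse c = xp_omega N ^ (2 * (k * (2 * N - 1)))"
    by (simp only: inverse_xp_omega_pow[OF assms(1)] mult.assoc)
  then show ?thesis unfolding even_phases_def by blast
qed

lemma even_phases_divide: "N \<ge> 1 \<Longrightarrow> c \<in> even_phases N \<Longrightarrow> d \<in> even_phases N \<Longrightarrow> c / d \<in> even_phases N"
  by (simp add: divide_inverse even_phases_mult even_phases_inverse)

text \<open>
  Tensor products of the matrices \<open>X\<^sup>b P\<^sup>k\<close> with a coefficient in \<open>C\<close>.  The powers of \<open>\<omega>\<close> as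
  coefficients give the XP group, all nonzero coefficients give the nonzero edge weights.
\<close>

primrec xp_monomials :: "nat \<Rightarrow> complex set \<Rightarrow> nat \<Rightarrow> complex mat set" where
  "xp_monomials N C 0 = {c \<cdot>\<^sub>m 1\<^sub>m 1 | c. c \<in> C}"
| "xp_monomials N C (Suc n) =
     {kron (phase_mat b c) A | b c A. c \<in> even_phases N \<and> A \<in> xp_monomials N C n}"

lemma xp_monomials_kronI:
  "c \<in> even_phases N \<Longrightarrow> A \<in> xp_monomials N C n \<Longrightarrow> kron (phase_mat b c) A \<in> xp_monomials N C (Suc n)"
  unfolding xp_monomials.simps by blast

section \<open>The monomials as a group of matrices\<close>

lemma xp_monomials_carrier: "A \<in> xp_monomials N C n \<Longrightarrow> A \<in> carrier_mat (2 ^ n) (2 ^ n)"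
proof (induction n arbitrary: A)
  case 0
  then show ?case by auto
next
  case (Suc n)
  then obtain b c B where "A = kron (phase_mat b c) B" "B \<in> xp_monomials N C n" by auto
  then show ?case using kron_carrier[OF phase_mat_carrier Suc.IH] by simp
qed

lemma xp_monomials_mono: "C \<subseteq> D \<Longrightarrow> xp_monomials N C n \<subseteq> xp_monomials N D n"
proof (induction n)
  case 0
  then show ?case by auto
next
  case (Suc n)
  then show ?case unfolding xp_monomials.simps by blast
qed

text \<open>The closure proofs are done once and used for the powers of \<omega> and for all nonzero
  complex numbers. \<open>C\<close> contains the even phases because these are the scalars that
  appear when P^k moves past X.\<close>

locale coeff_group =
  fixes N :: nat and C :: "complex set"
  assumes N_pos: "N \<ge> 1"
    and nonzero: "c \<in> C \<Longrightarrow> c \<noteq> 0"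
    and mult: "c \<in> C \<Longrightarrow> d \<in> C \<Longrightarrow> c * d \<in> C"
    and inverse: "c \<in> C \<Longrightarrow> inverse c \<in> C"
    and even_phases: "even_phases N \<subseteq> C"
begin

lemma one_coeff: "1 \<in> C"
  using even_phases even_phases_one by blast

lemma smult_mem: "A \<in> xp_monomials N C n \<Longrightarrow> c \<in> C \<Longrightarrow> c \<cdot>\<^sub>m A \<in> xp_monomials N C n"
proof (induction n arbitrary: A)
  case 0
  then show ?case using mult by (auto simp: smult_smult_mat)
next
  case (Suc n)
  then obtain b d B where A: "A = kron (phase_mat b d) B" "d \<in> even_phases N" "B \<in> xp_monomials N C n"
    by auto
  have "c \<cdot>\<^sub>m A = kron (phase_mat b d) (c \<cdot>\<^sub>m B)"
    using A xp_monomials_carrier by (simp add: kron_smult[of _ _ "2 ^ n"])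
  then show ?case using A Suc by (simp only: xp_monomials_kronI)
qed

lemma one_mem: "1\<^sub>m (2 ^ n) \<in> xp_monomials N C n"
proof (induction n)
  case 0
  show ?case using one_coeff one_smult_mat[of "1\<^sub>m 1"] by force
next
  case (Suc n)
  then show ?case unfolding one_mat_kron by (intro xp_monomials_kronI) simp_all
qed

lemma mult_mem:
  "A \<in> xp_monomials N C n \<Longrightarrow> B \<in> xp_monomials N C n \<Longrightarrow> A * B \<in> xp_monomials N C n"
proof (induction n arbitrary: A B)
  case 0
  then obtain a b where "A = a \<cdot>\<^sub>m 1\<^sub>m 1" "B = b \<cdot>\<^sub>m 1\<^sub>m 1" "a \<in> C" "b \<in> C" by auto
  moreover from this have "A * B = (a * b) \<cdot>\<^sub>m 1\<^sub>m 1"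
    by (auto intro!: eq_matI simp: scalar_prod_def)
  ultimately show ?case using mult by auto
next
  case (Suc n)
  then obtain b c A' b' c' B' where
    A: "A = kron (phase_mat b c) A'" "c \<in> even_phases N" "A' \<in> xp_monomials N C n" and
    B: "B = kron (phase_mat b' c') B'" "c' \<in> even_phases N" "B' \<in> xp_monomials N C n"
    by auto
  have AB: "A' * B' \<in> xp_monomials N C n" using Suc.IH A B by blast
  have eq: "A * B = kron (phase_mat b c * phase_mat b' c') (A' * B')"
    unfolding A B using A(3) B(3) by (intro kron_mult) (auto intro: xp_monomials_carrier)
  have "c \<noteq> 0" using A even_phases_nonzero by blast
  show ?case
  proof (cases b')
    case True
    \<comment> \<open>The phase \<open>c\<close> has passed X; the scalar it leaves behind goes into
      the remaining tensor factors.\<close>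
    then have "A * B = kron (phase_mat (\<not> b) (c' / c)) (c \<cdot>\<^sub>m (A' * B'))"
      using eq \<open>c \<noteq> 0\<close> AB[THEN xp_monomials_carrier]
      by (simp add: phase_mat_mult kron_smult[of _ _ "2 ^ n"])
    moreover have "c \<cdot>\<^sub>m (A' * B') \<in> xp_monomials N C n"
      using AB A(2) even_phases by (auto intro: smult_mem)
    moreover have "c' / c \<in> even_phases N" using A B N_pos by (blast intro: even_phases_divide)
    ultimately show ?thesis by (simp only: xp_monomials_kronI)
  next
    case False
    then have "A * B = kron (phase_mat b (c * c')) (A' * B')"
      using eq \<open>c \<noteq> 0\<close> by (simp add: phase_mat_mult)
    then show ?thesis using AB even_phases_mult[OF A(2) B(2)] by (simp only: xp_monomials_kronI)
  qed
qed

lemma inverse_mem: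
  "A \<in> xp_monomials N C n \<Longrightarrow>
    \<exists>B \<in> xp_monomials N C n. A * B = 1\<^sub>m (2 ^ n) \<and> B * A = 1\<^sub>m (2 ^ n)"
proof (induction n arbitrary: A)
  case 0
  then obtain a where a: "A = a \<cdot>\<^sub>m 1\<^sub>m 1" "a \<in> C" by auto
  have "a \<noteq> 0" using a nonzero by blast
  then have "A * (inverse a \<cdot>\<^sub>m 1\<^sub>m 1) = 1\<^sub>m (2 ^ 0)" "(inverse a \<cdot>\<^sub>m 1\<^sub>m 1) * A = 1\<^sub>m (2 ^ 0)"
    unfolding a by (auto intro!: eq_matI simp: scalar_prod_def)
  then show ?case using a inverse by auto
next
  case (Suc n)
  then obtain b c A' where A: "A = kron (phase_mat b c) A'" "c \<in> even_phases N" "A' \<in> xp_monomials N C n"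
    by auto
  obtain B where B: "B \<in> xp_monomials N C n" "A' * B = 1\<^sub>m (2 ^ n)" "B * A' = 1\<^sub>m (2 ^ n)"
    using Suc.IH A by blast
  have carrier: "A' \<in> carrier_mat (2 ^ n) (2 ^ n)" "B \<in> carrier_mat (2 ^ n) (2 ^ n)"
    using A B xp_monomials_carrier by blast+
  have c: "c \<noteq> 0" "inverse c \<in> even_phases N"
    using A N_pos even_phases_nonzero even_phases_inverse by blast+
  have km: "kron (phase_mat b c) D * kron (phase_mat b' c') D' = kron (phase_mat b c * phase_mat b' c') (D * D')"
    if "D \<in> carrier_mat (2 ^ n) (2 ^ n)" "D' \<in> carrier_mat (2 ^ n) (2 ^ n)" for b c D b' c' D'
    using that by (intro kron_mult) auto
  show ?case
  proof (cases b)
    case True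
    \<comment> \<open>X diag(1, c) squares to c I, so this factor is its own inverse up to the
      scalar 1/c.\<close>
    define B' where "B' = kron (phase_mat True c) (inverse c \<cdot>\<^sub>m B)"
    have "B' \<in> xp_monomials N C (Suc n)"
      unfolding B'_def using A B c even_phases by (intro xp_monomials_kronI smult_mem) auto
    moreover have "A * B' = 1\<^sub>m (2 ^ Suc n)" "B' * A = 1\<^sub>m (2 ^ Suc n)"
      unfolding A(1) B'_def one_mat_kron using True carrier c B
      by (simp_all add: km phase_mat_mult kron_smult(1)[of _ _ "2 ^ n"] mult_smult_distrib[OF carrier]
          mult_smult_assoc_mat[OF carrier(2,1)] smult_smult_mat one_smult_mat)
    ultimately show ?thesis by blast
  next
    case False
    define B' where "B' = kron (phase_mat False (inverse c)) B"
    have "B' \<in> xp_monomials N C (Suc n)"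
      unfolding B'_def using A B c by (intro xp_monomials_kronI)
    moreover have "A * B' = 1\<^sub>m (2 ^ Suc n)" "B' * A = 1\<^sub>m (2 ^ Suc n)"
      unfolding A(1) B'_def one_mat_kron using False carrier c B
      by (simp_all add: km phase_mat_mult)
    ultimately show ?thesis by blast
  qed
qed

lemma m_inv_eqI:
  assumes "A \<in> carrier_mat (2 ^ n) (2 ^ n)" "B \<in> carrier_mat (2 ^ n) (2 ^ n)"
    "A * B = 1\<^sub>m (2 ^ n)" "B * A = 1\<^sub>m (2 ^ n)"
  shows "m_inv (op_ring n) A = B"
proof -
  interpret R: ring "op_ring n" by (rule ring_mat)
  show ?thesis
    using R.inv_unique'[of A B] assms by (simp add: ring_mat_simps)
qed

lemma m_inv_mem:
  assumes "A \<in> xp_monomials N C n"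
  shows "m_inv (op_ring n) A \<in> xp_monomials N C n"
    "A * m_inv (op_ring n) A = 1\<^sub>m (2 ^ n)" "m_inv (op_ring n) A * A = 1\<^sub>m (2 ^ n)"
proof -
  obtain B where B: "B \<in> xp_monomials N C n" "A * B = 1\<^sub>m (2 ^ n)" "B * A = 1\<^sub>m (2 ^ n)"
    using inverse_mem[OF assms] by blast
  then have "m_inv (op_ring n) A = B"
    using assms xp_monomials_carrier by (intro m_inv_eqI) auto
  with B show "m_inv (op_ring n) A \<in> xp_monomials N C n"
    "A * m_inv (op_ring n) A = 1\<^sub>m (2 ^ n)" "m_inv (op_ring n) A * A = 1\<^sub>m (2 ^ n)" by auto
qed

end

section \<open>The XP group and the nonzero weights as sets of monomials\<close>

abbreviation weights :: "nat \<Rightarrow> nat \<Rightarrow> complex mat set" where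
  "weights N \<equiv> xp_monomials N (- {0})"

lemma coeff_group_phases:
  assumes "N \<ge> 1"
  shows "coeff_group N (phases N)"
proof
  show "c * d \<in> phases N" if cd: "c \<in> phases N" "d \<in> phases N" for c d
  proof -
    obtain p q where "c = xp_omega N ^ p" "d = xp_omega N ^ q" using cd by (auto simp: phases_def)
    then have "c * d = xp_omega N ^ (p + q)" by (simp add: power_add)
    then show ?thesis unfolding phases_def by blast
  qed
  show "inverse c \<in> phases N" if "c \<in> phases N" for c
    using that inverse_xp_omega_pow[OF assms] unfolding phases_def by blast
qed (use assms in \<open>auto simp: phases_def even_phases_def\<close>)

lemma coeff_group_nonzero: "N \<ge> 1 \<Longrightarrow> coeff_group N (- {0})"
  by unfold_locales (auto dest: even_phases_nonzero)

lemma xp_factor_eq: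
  assumes "x \<in> {0, 1}"
  shows "pauli_X ^\<^sub>m x * phase_P N ^\<^sub>m z = phase_mat (x = 1) (xp_omega N ^ (2 * z))"
proof -
  have "x < 2" using assms by auto
  then show ?thesis by (simp add: pauli_X_pow phase_P_pow phase_mat_mult)
qed

lemma kron_list_carrier:
  "\<forall>A \<in> set As. A \<in> carrier_mat 2 2 \<Longrightarrow> kron_list As \<in> carrier_mat (2 ^ length As) (2 ^ length As)"
proof (induction As)
  case (Cons A As)
  then show ?case using kron_carrier[of A "kron_list As" "length As"] by simp
qed simp

lemma xp_kron_list_carrier:
  assumes "length xs = n" "set xs \<subseteq> {0, 1}" "length zs = n"
  shows "kron_list (map2 (\<lambda>x z. pauli_X ^\<^sub>m x * phase_P N ^\<^sub>m z) xs zs) \<in> carrier_mat (2 ^ n) (2 ^ n)"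
proof -
  let ?As = "map2 (\<lambda>x z. pauli_X ^\<^sub>m x * phase_P N ^\<^sub>m z) xs zs"
  have "\<forall>A \<in> set ?As. A \<in> carrier_mat 2 2"
  proof
    fix A assume "A \<in> set ?As"
    then obtain x z where "A = pauli_X ^\<^sub>m x * phase_P N ^\<^sub>m z" "x \<in> set xs"
      by (auto dest: set_zip_leftD)
    then show "A \<in> carrier_mat 2 2" using assms(2) xp_factor_eq[of x N z] phase_mat_carrier by (metis subsetD)
  qed
  from kron_list_carrier[OF this] show ?thesis using assms by simp
qed

lemma xp_op_Cons:
  assumes "x \<in> {0, 1}" "length xs = n" "set xs \<subseteq> {0, 1}" "length zs = n"
  shows "xp_op N p (x # xs) (z # zs) = kron (phase_mat (x = 1) (xp_omega N ^ (2 * z))) (xp_op N p xs zs)"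
proof -
  have "kron_list (map2 (\<lambda>x z. pauli_X ^\<^sub>m x * phase_P N ^\<^sub>m z) xs zs) \<in> carrier_mat (2 ^ n) (2 ^ n)"
    using assms by (intro xp_kron_list_carrier)
  then show ?thesis
    using xp_factor_eq[OF assms(1)] by (simp add: xp_op_def kron_smult[of _ _ "2 ^ n"])
qed

lemma xp_op_mem: "xp_params N n p xs zs \<Longrightarrow> xp_op N p xs zs \<in> xp_monomials N (phases N) n"
proof (induction n arbitrary: xs zs)
  case 0
  then show ?case by (auto simp: xp_params_def xp_op_def phases_def)
next
  case (Suc n)
  then obtain x xs' z zs' where xz: "xs = x # xs'" "zs = z # zs'"
    by (auto simp: xp_params_def length_Suc_conv)
  then have par: "xp_params N n p xs' zs'" "x \<in> {0, 1}" using Suc.prems by (auto simp: xp_params_def)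
  then have "xp_op N p xs zs = kron (phase_mat (x = 1) (xp_omega N ^ (2 * z))) (xp_op N p xs' zs')"
    unfolding xz by (intro xp_op_Cons[of _ _ n]) (auto simp: xp_params_def)
  then show ?case
    using Suc.IH[OF par(1)] xp_monomials_kronI[of "xp_omega N ^ (2 * z)" N]
    by (simp add: even_phases_def del: xp_monomials.simps)
qed

lemma xp_monomials_phases_cases:
  assumes "N \<ge> 1"
  shows "A \<in> xp_monomials N (phases N) n \<Longrightarrow> \<exists>p xs zs. xp_params N n p xs zs \<and> A = xp_op N p xs zs"
proof (induction n arbitrary: A)
  case 0
  then obtain p where "p < 2 * N" "A = xp_omega N ^ p \<cdot>\<^sub>m 1\<^sub>m 1" by (auto simp: phases_eq[OF assms])
  then have "xp_params N 0 p [] [] \<and> A = xp_op N p [] []" by (simp add: xp_params_def xp_op_def)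
  then show ?case by blast
next
  case (Suc n)
  then obtain b k B where A: "A = kron (phase_mat b (xp_omega N ^ (2 * k))) B" "k < N"
    "B \<in> xp_monomials N (phases N) n"
    by (auto simp: even_phases_eq[OF assms])
  then obtain p xs zs where B: "xp_params N n p xs zs" "B = xp_op N p xs zs" using Suc.IH by blast
  have "xp_params N (Suc n) p (of_bool b # xs) (k # zs)" using B(1) A(2) by (auto simp: xp_params_def)
  moreover have "A = xp_op N p (of_bool b # xs) (k # zs)"
    using B A(1) by (subst xp_op_Cons[of _ _ n]) (auto simp: xp_params_def)
  ultimately show ?case by blast
qed

text \<open>The generators are exactly the monomials with coefficients in \<open>phases N\<close>,
  which are already closed under products and inverses.\<close>

lemma xp_group_eq:
  assumes "N \<ge> 1"
  shows "xp_group N n = xp_monomials N (phases N) n"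
proof -
  interpret coeff_group N "phases N" by (rule coeff_group_phases[OF assms])
  have gens: "{xp_op N p xs zs | p xs zs. xp_params N n p xs zs} = xp_monomials N (phases N) n"
    using xp_op_mem xp_monomials_phases_cases[OF assms] by blast
  show ?thesis
    unfolding xp_group_def gens
  proof
    show "generate (op_ring n) (xp_monomials N (phases N) n) \<subseteq> xp_monomials N (phases N) n"
    proof
      fix A assume "A \<in> generate (op_ring n) (xp_monomials N (phases N) n)"
      then show "A \<in> xp_monomials N (phases N) n"
      proof induction
        case one
        then show ?case by (simp add: ring_mat_simps one_mem)
      next
        case (eng A B)
        then show ?case by (simp add: ring_mat_simps mult_mem)
      qed (simp_all add: m_inv_mem)
    qed
  qed (blast intro: generate.incl)
qed

text \<open>The scalar sits in the innermost coefficient, from where it can be pulled out in front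
  of the tensor product.\<close>

lemma weights_cases:
  assumes "N \<ge> 1"
  shows "w \<in> weights N n \<Longrightarrow> \<exists>c A. c \<noteq> 0 \<and> A \<in> xp_monomials N (phases N) n \<and> w = c \<cdot>\<^sub>m A"
proof (induction n arbitrary: w)
  case 0
  interpret coeff_group N "phases N" by (rule coeff_group_phases[OF assms])
  from 0 obtain c where "c \<noteq> 0" "w = c \<cdot>\<^sub>m 1\<^sub>m 1" by auto
  then show ?case using one_mem[of 0] by (metis power_0)
next
  case (Suc n)
  then obtain b d B where w: "w = kron (phase_mat b d) B" "d \<in> even_phases N" "B \<in> weights N n"
    by auto
  then obtain c A where A: "c \<noteq> 0" "A \<in> xp_monomials N (phases N) n" "B = c \<cdot>\<^sub>m A"
    using Suc.IH by blast
  have "w = c \<cdot>\<^sub>m kron (phase_mat b d) A"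
    unfolding w A using xp_monomials_carrier[OF A(2)] by (simp add: kron_smult[of _ _ "2 ^ n"])
  then show ?case using A(1) xp_monomials_kronI[OF w(2) A(2)] by blast
qed

lemma phases_subset_nonzero: "phases N \<subseteq> - {0}"
  by (auto simp: phases_def)

lemma weights_memI:
  assumes "N \<ge> 1" "c \<noteq> 0" "A \<in> xp_monomials N (phases N) n"
  shows "c \<cdot>\<^sub>m A \<in> weights N n"
  using coeff_group.smult_mem[OF coeff_group_nonzero[OF assms(1)], of A n c]
    xp_monomials_mono[OF phases_subset_nonzero] assms by blast

section \<open>Eigenvalues of XP operators\<close>

lemma vec_split:
  assumes "v \<in> carrier_vec (2 ^ Suc n)"
  obtains u u' where "u \<in> carrier_vec (2 ^ n)" "u' \<in> carrier_vec (2 ^ n)" "v = u @\<^sub>v u'"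
  using assms by (metis mult_2 power_Suc vec_first_carrier vec_last_carrier vec_first_last_append)

text \<open>
  Each tensor factor of an XP operator squares to \<open>diag(1, \<omega>\<^sup>4\<^sup>k)\<close> or to \<open>\<omega>\<^sup>2\<^sup>k I\<close>, so the square of
  the whole operator is diagonal with even powers of \<open>\<omega>\<close> on the diagonal.
\<close>

lemma xp_monomials_square:
  assumes "N \<ge> 1"
  shows "A \<in> xp_monomials N (phases N) n \<Longrightarrow> v \<in> carrier_vec (2 ^ n) \<Longrightarrow> i < 2 ^ n \<Longrightarrow>
    \<exists>d \<in> even_phases N. (A *\<^sub>v (A *\<^sub>v v)) $ i = d * v $ i"
proof (induction n arbitrary: A v i)
  case 0
  then obtain p where A: "A = xp_omega N ^ p \<cdot>\<^sub>m 1\<^sub>m 1" by (auto simp: phases_def)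
  have v: "v \<in> carrier_vec 1" "i = 0" using 0 by auto
  have "A *\<^sub>v (A *\<^sub>v v) = xp_omega N ^ p \<cdot>\<^sub>v (xp_omega N ^ p \<cdot>\<^sub>v v)"
    unfolding A using v by (simp add: smult_mat_mult_vec)
  then have "(A *\<^sub>v (A *\<^sub>v v)) $ i = xp_omega N ^ (2 * p) * v $ i"
    using v by (simp add: power_add mult_2)
  then show ?case unfolding even_phases_def by blast
next
  case (Suc n)
  then obtain b c B where A: "A = kron (phase_mat b c) B" "c \<in> even_phases N"
    "B \<in> xp_monomials N (phases N) n" by auto
  obtain u u' where u: "u \<in> carrier_vec (2 ^ n)" "u' \<in> carrier_vec (2 ^ n)" "v = u @\<^sub>v u'"
    using vec_split Suc.prems by blast
  have B: "B \<in> carrier_mat (2 ^ n) (2 ^ n)" using A xp_monomials_carrier by blast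
  have Bv: "B *\<^sub>v x \<in> carrier_vec (2 ^ n)" for x using B by (intro carrier_vecI) simp
  define d d' where "d = (if b then c else 1)" and "d' = (if b then c else c * c)"
  have d: "d \<in> even_phases N" "d' \<in> even_phases N" using A(2) even_phases_mult by (auto simp: d_def d'_def)
  have eq: "A *\<^sub>v (A *\<^sub>v v) = (d \<cdot>\<^sub>v (B *\<^sub>v (B *\<^sub>v u))) @\<^sub>v (d' \<cdot>\<^sub>v (B *\<^sub>v (B *\<^sub>v u')))"
    unfolding A(1) u(3) d_def d'_def using u(1,2) B Bv
    by (cases b) (simp_all add: kron_phase_mat_vec[OF B] mult_mat_vec[OF B] smult_smult_assoc)
  show ?case
  proof (cases "i < 2 ^ n")
    case True
    then obtain e where e: "e \<in> even_phases N" "(B *\<^sub>v (B *\<^sub>v u)) $ i = e * u $ i"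
      using Suc.IH A(3) u(1) by blast
    have "(A *\<^sub>v (A *\<^sub>v v)) $ i = (d * e) * v $ i"
      using True u e Bv[THEN carrier_vecD] by (subst eq) (simp del: index_mult_mat_vec)
    then show ?thesis using even_phases_mult d e by blast
  next
    case False
    then have i: "i - 2 ^ n < 2 ^ n" "i < 2 ^ n + 2 ^ n" using Suc.prems by auto
    then obtain e where e: "e \<in> even_phases N" "(B *\<^sub>v (B *\<^sub>v u')) $ (i - 2 ^ n) = e * u' $ (i - 2 ^ n)"
      using Suc.IH A(3) u(2) by blast
    have "(A *\<^sub>v (A *\<^sub>v v)) $ i = (d' * e) * v $ i"
      using False i u e Bv[THEN carrier_vecD] by (subst eq) (simp del: index_mult_mat_vec)
    then show ?thesis using even_phases_mult d e by blast
  qed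
qed

text \<open>Eigenvalues of XP operators are powers of \<open>\<omega>\<close>, because \<open>\<omega>\<^sup>N = -1\<close> supplies the sign of a square root.\<close>

lemma weight_fixing_nonzero_vec:
  assumes N: "N \<ge> 1" and w: "w \<in> weights N n" and v: "v \<in> carrier_vec (2 ^ n)" "v \<noteq> 0\<^sub>v (2 ^ n)"
    and fixed: "w *\<^sub>v v = v"
  shows "w \<in> xp_monomials N (phases N) n"
proof -
  interpret coeff_group N "phases N" by (rule coeff_group_phases[OF N])
  obtain c A where A: "c \<noteq> 0" "A \<in> xp_monomials N (phases N) n" "w = c \<cdot>\<^sub>m A"
    using weights_cases[OF N w] by blast
  have Ac: "A \<in> carrier_mat (2 ^ n) (2 ^ n)" using A xp_monomials_carrier by blast
  have Av: "A *\<^sub>v x \<in> carrier_vec (2 ^ n)" for x using Ac by (intro carrier_vecI) simp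
  \<comment> \<open>One nonzero entry of \<open>v\<close> suffices: \<open>A\<close> squared is
    diagonal, so this coordinate turns w w v = v into c^2 d = 1.\<close>
  obtain i where i: "i < 2 ^ n" "v $ i \<noteq> 0"
    using v by (metis carrier_vecD eq_vecI index_zero_vec)
  have "v = w *\<^sub>v (w *\<^sub>v v)" using fixed by simp
  also have "\<dots> = (c * c) \<cdot>\<^sub>v (A *\<^sub>v (A *\<^sub>v v))"
    unfolding A(3) using Ac v(1) Av by (simp add: smult_mat_mult_vec mult_mat_vec[OF Ac] smult_smult_assoc)
  finally have "v $ i = (c * c) * (A *\<^sub>v (A *\<^sub>v v)) $ i"
    using i Av[THEN carrier_vecD] by (metis index_smult_vec(1))
  moreover obtain d where d: "d \<in> even_phases N" "(A *\<^sub>v (A *\<^sub>v v)) $ i = d * v $ i"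
    using xp_monomials_square[OF N A(2) v(1) i(1)] by blast
  ultimately have "c * c * d = 1" using i(2) by (simp add: mult.assoc)
  moreover obtain k where k: "inverse d = xp_omega N ^ (2 * k)"
    using even_phases_inverse[OF N d(1)] by (auto simp: even_phases_def)
  ultimately have "c * c = inverse d" by (metis inverse_unique mult.commute)
  then have "c ^ 2 = (xp_omega N ^ k) ^ 2" by (simp add: k power2_eq_square power_add mult_2)
  then have "c = xp_omega N ^ k \<or> c = - (xp_omega N ^ k)" by (simp add: power2_eq_iff)
  moreover have "- (xp_omega N ^ k) = xp_omega N ^ (N + k)" by (simp add: power_add xp_omega_pow_N[OF N])
  ultimately have "c \<in> phases N" unfolding phases_def by (metis rangeI)
  then show ?thesis using A smult_mem by blast
qed

text \<open>Weights are invertible. This is what separates ordinary edges from zero edges.\<close>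

lemma weight_nonzero:
  assumes "N \<ge> 1" "w \<in> weights N n"
  shows "w \<noteq> 0\<^sub>m (2 ^ n) (2 ^ n)"
proof
  interpret coeff_group N "- {0}" by (rule coeff_group_nonzero[OF assms(1)])
  assume w: "w = 0\<^sub>m (2 ^ n) (2 ^ n)"
  obtain B where B: "B \<in> weights N n" "w * B = 1\<^sub>m (2 ^ n)" using inverse_mem[OF assms(2)] by blast
  then have "(1\<^sub>m (2 ^ n) :: complex mat) = 0\<^sub>m (2 ^ n) (2 ^ n)"
    using w left_mult_zero_mat[of B "2 ^ n" "2 ^ n" "2 ^ n"] xp_monomials_carrier[OF B(1)] by simp
  then have "(1\<^sub>m (2 ^ n) :: complex mat) $$ (0, 0) = 0\<^sub>m (2 ^ n) (2 ^ n) $$ (0, 0)" by simp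
  then show False by simp
qed

section \<open>Keys of weights\<close>

lemma cis_2pi_inject:
  assumes "cis (2 * pi * a) = cis (2 * pi * b)" "0 \<le> a" "a < 1" "0 \<le> b" "b < 1"
  shows "a = b"
proof -
  have "cis (2 * pi * a - 2 * pi * b) = 1" using assms(1) by (simp flip: cis_divide)
  then have "cos (2 * pi * a - 2 * pi * b) = 1" by (simp add: complex_eq_iff)
  then obtain m :: int where "2 * pi * a - 2 * pi * b = m * 2 * pi" by (auto simp: cos_one_2pi_int)
  then have "2 * pi * (a - b) = 2 * pi * m" by (simp add: algebra_simps)
  then have m: "a - b = m" by simp
  then have "-1 < m" "m < 1" using assms by linarith+
  then show ?thesis using m by simp
qed

lemma xp_omega_pow_2pi: "xp_omega N ^ p = cis (2 * pi * (real p / (2 * real N)))"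
  by (simp add: xp_omega_pow mult.commute)

lemma xp_omega_pow_inject:
  assumes "xp_omega N ^ (2 * k) = xp_omega N ^ (2 * l)" "k < N" "l < N"
  shows "k = l"
proof -
  have "real k / real N = real l / real N"
    using assms by (intro cis_2pi_inject) (auto simp: xp_omega_pow_2pi)
  then show ?thesis using assms by simp
qed

text \<open>The exponents of X and P are read off qubit by qubit. At the innermost level only the
  product of the coefficient and \<omega>^p is visible, since the two phases can be traded against
  each other.\<close>

lemma xp_op_inject:
  assumes "N \<ge> 1"
  shows "xp_params N n p xs zs \<Longrightarrow> xp_params N n p' xs' zs' \<Longrightarrow> c \<noteq> 0 \<Longrightarrow>
    c \<cdot>\<^sub>m xp_op N p xs zs = c' \<cdot>\<^sub>m xp_op N p' xs' zs' \<Longrightarrow>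
    xs = xs' \<and> zs = zs' \<and> c * xp_omega N ^ p = c' * xp_omega N ^ p'"
proof (induction n arbitrary: xs zs xs' zs')
  case 0
  then have nil: "xs = []" "zs = []" "xs' = []" "zs' = []" by (auto simp: xp_params_def)
  have "(c \<cdot>\<^sub>m xp_op N p xs zs) $$ (0, 0) = (c' \<cdot>\<^sub>m xp_op N p' xs' zs') $$ (0, 0)" using 0 by simp
  then show ?case by (simp add: nil xp_op_def)
next
  case (Suc n)
  obtain x ys z us where xz: "xs = x # ys" "zs = z # us" using Suc.prems(1)
    by (auto simp: xp_params_def length_Suc_conv)
  obtain x' ys' z' us' where xz': "xs' = x' # ys'" "zs' = z' # us'" using Suc.prems(2)
    by (auto simp: xp_params_def length_Suc_conv)
  have par: "xp_params N n p ys us" "x \<in> {0, 1}" "z < N"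
    and par': "xp_params N n p' ys' us'" "x' \<in> {0, 1}" "z' < N"
    using Suc.prems by (auto simp: xp_params_def xz xz')
  have c: "xp_op N p ys us \<in> carrier_mat (2 ^ n) (2 ^ n)" "xp_op N p' ys' us' \<in> carrier_mat (2 ^ n) (2 ^ n)"
    using xp_op_mem par(1) par'(1) xp_monomials_carrier by blast+
  have e: "c \<cdot>\<^sub>m xp_op N p xs zs = kron (phase_mat (x = 1) (xp_omega N ^ (2 * z))) (c \<cdot>\<^sub>m xp_op N p ys us)"
    unfolding xz using par c
    by (subst xp_op_Cons[of _ _ n]) (auto simp: xp_params_def kron_smult[of _ _ "2 ^ n"])
  have e': "c' \<cdot>\<^sub>m xp_op N p' xs' zs' = kron (phase_mat (x' = 1) (xp_omega N ^ (2 * z'))) (c' \<cdot>\<^sub>m xp_op N p' ys' us')"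
    unfolding xz' using par' c
    by (subst xp_op_Cons[of _ _ n]) (auto simp: xp_params_def kron_smult[of _ _ "2 ^ n"])
  have nz: "c \<cdot>\<^sub>m xp_op N p ys us \<noteq> 0\<^sub>m (2 ^ n) (2 ^ n)"
    using weight_nonzero[OF assms] weights_memI[OF assms Suc.prems(3) xp_op_mem[OF par(1)]] by blast
  have k: "kron (phase_mat (x = 1) (xp_omega N ^ (2 * z))) (c \<cdot>\<^sub>m xp_op N p ys us) =
     kron (phase_mat (x' = 1) (xp_omega N ^ (2 * z'))) (c' \<cdot>\<^sub>m xp_op N p' ys' us')"
    using e e' Suc.prems(4) by simp
  have cc: "c \<cdot>\<^sub>m xp_op N p ys us \<in> carrier_mat (2 ^ n) (2 ^ n)"
    "c' \<cdot>\<^sub>m xp_op N p' ys' us' \<in> carrier_mat (2 ^ n) (2 ^ n)" using c by auto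
  note inj = kron_phase_mat_inject[OF cc nz k]
  have "x = x'" using inj(1) par(2) par'(2) by auto
  moreover have "z = z'" using inj(3) xp_omega_pow_inject par(3) par'(3) by blast
  moreover have "ys = ys' \<and> us = us' \<and> c * xp_omega N ^ p = c' * xp_omega N ^ p'"
    using Suc.IH[OF par(1) par'(1) Suc.prems(3) inj(2)] .
  ultimately show ?case by (simp add: xz xz')
qed

text \<open>The norm gives r. The total phase, measured in full turns, is \<theta> + p/(2N); it lies
  in [0, 1) and is therefore determined by the matrix. The bound on \<theta> then separates its two
  summands.\<close>

lemma has_key_unique:
  assumes N: "N \<ge> 1" and w: "w \<noteq> 0\<^sub>m (2 ^ n) (2 ^ n)" and "has_key N n w k" "has_key N n w k'"
  shows "k = k'"
proof -
  obtain xs zs r \<theta> p where k: "k = (xs, zs, r, \<theta>, p)" by (cases k)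
  obtain xs' zs' r' \<theta>' p' where k': "k' = (xs', zs', r', \<theta>', p')" by (cases k')
  have key: "xp_params N n p xs zs" "0 \<le> r" "0 \<le> \<theta>" "\<theta> < 1 / (2 * real N)"
    "w = (of_real r * cis (2 * pi * \<theta>)) \<cdot>\<^sub>m xp_op N p xs zs"
    using assms(3) by (simp_all add: k has_key_def cis_conv_exp mult_ac)
  have key': "xp_params N n p' xs' zs'" "0 \<le> r'" "0 \<le> \<theta>'" "\<theta>' < 1 / (2 * real N)"
    "w = (of_real r' * cis (2 * pi * \<theta>')) \<cdot>\<^sub>m xp_op N p' xs' zs'"
    using assms(4) by (simp_all add: k' has_key_def cis_conv_exp mult_ac)
  have "r \<noteq> 0"
  proof
    assume "r = 0"
    then have "w = 0\<^sub>m (2 ^ n) (2 ^ n)"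
      using key(5) xp_monomials_carrier[OF xp_op_mem[OF key(1)]] by (intro eq_matI) auto
    then show False using w by simp
  qed
  then have eq: "xs = xs'" "zs = zs'"
    "of_real r * cis (2 * pi * \<theta>) * xp_omega N ^ p = of_real r' * cis (2 * pi * \<theta>') * xp_omega N ^ p'"
    using xp_op_inject[OF N key(1) key'(1), of "of_real r * cis (2 * pi * \<theta>)" "of_real r' * cis (2 * pi * \<theta>')"]
      key(5) key'(5) by auto
  have eq': "of_real r * cis (2 * pi * (\<theta> + real p / (2 * real N))) =
      of_real r' * cis (2 * pi * (\<theta>' + real p' / (2 * real N)))"
    using eq(3) by (simp add: xp_omega_pow_2pi cis_mult distrib_left mult.assoc)
  have "r = r'" using arg_cong[OF eq', of norm] key(2) key'(2) by (simp add: norm_mult)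
  then have "cis (2 * pi * (\<theta> + real p / (2 * real N))) = cis (2 * pi * (\<theta>' + real p' / (2 * real N)))"
    using eq' \<open>r \<noteq> 0\<close> by simp
  moreover have "\<theta> + real p / (2 * real N) < 1" if "\<theta> < 1 / (2 * real N)" "p < 2 * N" for \<theta> p
  proof -
    have "real (p + 1) \<le> real (2 * N)" using that(2) by (simp only: of_nat_le_iff)
    then have "(1 + real p) / (2 * real N) \<le> 1" using N by (simp add: divide_le_eq)
    then show ?thesis using that(1) by (simp add: add_divide_distrib)
  qed
  ultimately have sum: "\<theta> + real p / (2 * real N) = \<theta>' + real p' / (2 * real N)"
    using key key' by (intro cis_2pi_inject) (auto simp: xp_params_def)
  \<comment> \<open>On the scale of 1/(2N) turns, \<open>p\<close> is the integer part and
    \<open>t\<close> the fractional part of the same number.\<close>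
  define t t' where "t = \<theta> * (2 * real N)" and "t' = \<theta>' * (2 * real N)"
  have t: "0 \<le> t" "t < 1" "0 \<le> t'" "t' < 1"
    unfolding t_def t'_def using N key(3,4) key'(3,4) by (auto simp: field_simps)
  have tp: "t + real p = t' + real p'"
    using sum N by (simp add: t_def t'_def field_simps)
  then have "\<bar>int p - int p'\<bar> < 1" using t by linarith
  then have "p = p'" by linarith
  moreover then have "\<theta> = \<theta>'" using tp N by (simp add: t_def t'_def)
  ultimately show ?thesis using eq \<open>r = r'\<close> by (simp add: k k')
qed

lemma asym_key_less: "asym key_less"
proof -
  have "asym (lexord less_than)"
    by (intro asymI lexord_asym[rotated]) (auto intro: asymI)
  moreover have "asym {(r, s :: real). r < s}" by (auto intro!: asymI)
  moreover have "asym less_than" by (auto intro!: asymI)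
  ultimately show ?thesis unfolding key_less_def by (intro asym_lex_prod)
qed

text \<open>Two different smallest elements would each precede the other. \<open>weight_less\<close>
  chooses its keys existentially; uniqueness of keys brings both comparisons to the same pair of
  keys, where asymmetry applies.\<close>

lemma smallest_weight_unique:
  assumes N: "N \<ge> 1" and W: "W \<subseteq> weights N n"
    and w: "smallest_weight N n W w" and w': "smallest_weight N n W w'"
  shows "w = w'"
proof (rule ccontr)
  assume "w \<noteq> w'"
  then have "weight_less N n w w'" "weight_less N n w' w" using w w' by (auto simp: smallest_weight_def)
  then obtain k k' l l' where key: "has_key N n w k" "has_key N n w' k'" "(k, k') \<in> key_less"
    "has_key N n w l" "has_key N n w' l'" "(l', l) \<in> key_less" by (auto simp: weight_less_def)
  have "w \<in> weights N n" "w' \<in> weights N n" using w w' W by (auto simp: smallest_weight_def)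
  then have "k = l" "k' = l'" using has_key_unique[OF N] weight_nonzero[OF N] key by blast+
  then show False using key asymD[OF asym_key_less] by blast
qed

section \<open>Tensors and tables\<close>

lemma tvec_carrier [simp]: "tvec n \<phi> \<in> carrier_vec (2 ^ n)"
  by (simp add: tvec_def)

lemma dim_tvec [simp]: "dim_vec (tvec n \<phi>) = 2 ^ n"
  by (simp add: tvec_def)

text \<open>The head of the bit list is the most significant bit of the vector index, so the slices
  are the two halves of the vector.\<close>

lemma tvec_Suc: "tvec (Suc n) \<phi> = tvec n (slice False \<phi>) @\<^sub>v tvec n (slice True \<phi>)"
proof (rule eq_vecI)
  fix i assume "i < dim_vec (tvec n (slice False \<phi>) @\<^sub>v tvec n (slice True \<phi>))"
  then have i: "i < 2 ^ n + 2 ^ n" by simp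
  show "tvec (Suc n) \<phi> $ i = (tvec n (slice False \<phi>) @\<^sub>v tvec n (slice True \<phi>)) $ i"
  proof (cases "i < 2 ^ n")
    case True
    then have "\<not> bit i n" by (simp add: bit_iff_odd)
    then show ?thesis using True i by (simp add: tvec_def slice_def)
  next
    case False
    \<comment> \<open>Subtracting 2^n clears bit \<open>n\<close> of \<open>i\<close> and keeps all
      lower bits.\<close>
    define j where "j = i - 2 ^ n"
    have j: "i = j + 2 ^ n" "j < 2 ^ n" using False i by (auto simp: j_def)
    have "bit i n" using j by (simp add: bit_iff_odd)
    moreover have "bit i k = bit j k" if "k < n" for k
    proof -
      have "take_bit n i = j" using j by (simp add: take_bit_eq_mod)
      then show ?thesis using that bit_take_bit_iff[of n i k] by simp
    qed
    then have "map (bit i) (rev [0..<n]) = map (bit j) (rev [0..<n])" by (simp add: map_eq_conv)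
    moreover have "(tvec n (slice False \<phi>) @\<^sub>v tvec n (slice True \<phi>)) $ i = tvec n (slice True \<phi>) $ j"
      using False i by (simp add: j_def)
    moreover have "tvec (Suc n) \<phi> $ i = \<phi> (bit i n # map (bit i) (rev [0..<n]))"
      using i by (simp add: tvec_def)
    ultimately show ?thesis using j(2) by (simp only: tvec_def slice_def index_vec)
  qed
qed simp

text \<open>\<open>horner_sum\<close> reverses the binary expansion used in
  \<open>tvec\<close>.\<close>

lemma tvec_act:
  assumes "A \<in> carrier_mat (2 ^ n) (2 ^ n)"
  shows "tvec n (act n A \<phi>) = A *\<^sub>v tvec n \<phi>"
proof (rule eq_vecI)
  fix i assume "i < dim_vec (A *\<^sub>v tvec n \<phi>)"
  then have i: "i < 2 ^ n" using assms by simp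
  have "horner_sum of_bool 2 (rev (map (bit i) (rev [0..<n]))) = take_bit n i"
    by (simp add: rev_map horner_sum_bit_eq_take_bit)
  also have "\<dots> = i" using i by (simp add: take_bit_nat_eq_self)
  finally show "tvec n (act n A \<phi>) $ i = (A *\<^sub>v tvec n \<phi>) $ i"
    using i by (simp add: tvec_def act_def)
qed (use assms in simp)

section \<open>Node vectors under growth of the table\<close>

abbreviation node_vec :: "table \<Rightarrow> nat \<Rightarrow> nat \<Rightarrow> complex vec" where
  "node_vec T n v \<equiv> tvec n (node_tensor T n v)"

lemma node_vec_Suc:
  assumes "0 < v" "T ! (v - 1) = u" "node_index u = Suc n"
    "low_weight u \<in> carrier_mat (2 ^ n) (2 ^ n)" "high_weight u \<in> carrier_mat (2 ^ n) (2 ^ n)"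
  shows "node_vec T (Suc n) v =
    (low_weight u *\<^sub>v node_vec T n (low u)) @\<^sub>v (high_weight u *\<^sub>v node_vec T n (high u))"
proof -
  have "slice False (node_tensor T (Suc n) v) = act n (low_weight u) (node_tensor T n (low u))"
    "slice True (node_tensor T (Suc n) v) = act n (high_weight u) (node_tensor T n (high u))"
    using assms(1-3) by (simp_all add: slice_def)
  then show ?thesis using assms(4,5) unfolding tvec_Suc by (simp only: tvec_act)
qed

text \<open>Entry \<open>i\<close> is node \<open>i + 1\<close>, so the bound \<open>i\<close> says
  that children are strictly older than their parent, the terminal node 0 included.\<close>

definition good_table :: "table \<Rightarrow> bool" where
  "good_table T \<longleftrightarrow> distinct T \<and> (\<forall>i < length T. low (T ! i) \<le> i \<and> high (T ! i) \<le> i)"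

text \<open>Following edges only leads to older nodes, so the appended entries are never
  reached.\<close>

lemma node_tensor_append:
  assumes "good_table T"
  shows "v \<le> length T \<Longrightarrow> node_tensor (T @ S) n v = node_tensor T n v"
proof (induction n arbitrary: v)
  case (Suc n)
  show ?case
  proof (cases "v = 0")
    case True
    then show ?thesis using Suc by simp
  next
    case False
    then have v: "v - 1 < length T" using Suc.prems by linarith
    then have "low (T ! (v - 1)) \<le> v - 1" "high (T ! (v - 1)) \<le> v - 1"
      using assms unfolding good_table_def by blast+
    then have "node_tensor (T @ S) n (low (T ! (v - 1))) = node_tensor T n (low (T ! (v - 1)))"
      "node_tensor (T @ S) n (high (T ! (v - 1))) = node_tensor T n (high (T ! (v - 1)))"
      using Suc.prems by (auto intro!: Suc.IH)
    then show ?thesis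
      by (simp only: node_tensor.simps Let_def nth_append_left[OF v] Suc.IH[OF Suc.prems])
  qed
qed simp

lemma good_table_nth_inject:
  assumes "good_table T" "0 < v" "v \<le> length T" "0 < v'" "v' \<le> length T" "T ! (v - 1) = T ! (v' - 1)"
  shows "v = v'"
proof -
  have "v - 1 = v' - 1"
    using assms by (subst nth_eq_iff_index_eq[symmetric, of T]) (auto simp: good_table_def)
  then show ?thesis using assms by simp
qed

lemma intern_good_table:
  assumes "good_table T" "intern T u T' v" "low u \<le> length T" "high u \<le> length T"
  shows "good_table T'" "\<exists>S. T' = T @ S" "0 < v" "v \<le> length T'" "T' ! (v - 1) = u"
  using assms by (auto simp: intern_def good_table_def nth_append less_Suc_eq split: if_splits)

section \<open>Candidate high weights\<close>

lemma mat_vec_carrier: "A \<in> carrier_mat m k \<Longrightarrow> A *\<^sub>v x \<in> carrier_vec m"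
  by (intro carrier_vecI) simp

lemma weights_mult: "N \<ge> 1 \<Longrightarrow> a \<in> weights N n \<Longrightarrow> b \<in> weights N n \<Longrightarrow> a * b \<in> weights N n"
  by (rule coeff_group.mult_mem[OF coeff_group_nonzero])

lemma weights_smult: "N \<ge> 1 \<Longrightarrow> a \<in> weights N n \<Longrightarrow> c \<noteq> 0 \<Longrightarrow> c \<cdot>\<^sub>m a \<in> weights N n"
  by (rule coeff_group.smult_mem[OF coeff_group_nonzero]) auto

lemma weights_left_cancel_vec:
  assumes "N \<ge> 1" "a \<in> weights N n" "x \<in> carrier_vec (2 ^ n)" "y \<in> carrier_vec (2 ^ n)" "a *\<^sub>v x = a *\<^sub>v y"
  shows "x = y"
proof -
  obtain b where b: "b \<in> weights N n" "b * a = 1\<^sub>m (2 ^ n)"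
    using coeff_group.inverse_mem[OF coeff_group_nonzero] assms(1,2) by blast
  have "b *\<^sub>v (a *\<^sub>v z) = z" if z: "z \<in> carrier_vec (2 ^ n)" for z
    using assoc_mult_mat_vec[OF xp_monomials_carrier[OF b(1)] xp_monomials_carrier[OF assms(2)] z] z b(2) by simp
  then show ?thesis using assms(3-5) by metis
qed

lemma weights_mult_vec_eq_0_iff:
  assumes "N \<ge> 1" "a \<in> weights N n" "x \<in> carrier_vec (2 ^ n)"
  shows "a *\<^sub>v x = 0\<^sub>v (2 ^ n) \<longleftrightarrow> x = 0\<^sub>v (2 ^ n)"
proof -
  have "a *\<^sub>v 0\<^sub>v (2 ^ n) = 0\<^sub>v (2 ^ n)" using xp_monomials_carrier[OF assms(2)] by auto
  then show ?thesis using weights_left_cancel_vec[OF assms(1-3), of "0\<^sub>v (2 ^ n)"] by auto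
qed

lemma weights_left_cancel:
  assumes "N \<ge> 1" "a \<in> weights N n" "X \<in> carrier_mat (2 ^ n) (2 ^ n)" "Y \<in> carrier_mat (2 ^ n) (2 ^ n)"
    "a * X = a * Y"
  shows "X = Y"
proof -
  obtain b where b: "b \<in> weights N n" "b * a = 1\<^sub>m (2 ^ n)"
    using coeff_group.inverse_mem[OF coeff_group_nonzero] assms(1,2) by blast
  have "b * (a * Z) = Z" if z: "Z \<in> carrier_mat (2 ^ n) (2 ^ n)" for Z
    using assoc_mult_mat[OF xp_monomials_carrier[OF b(1)] xp_monomials_carrier[OF assms(2)] z] z b(2) by simp
  then show ?thesis using assms(3-5) by metis
qed

section \<open>Stabilizers of nodes\<close>

lemma stab_eq:
  "N \<ge> 1 \<Longrightarrow> stab N T n v =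
    {A \<in> xp_monomials N (phases N) n. A *\<^sub>v node_vec T n v = node_vec T n v}"
  by (simp add: stab_def xp_group_eq)

lemma stab_weights: "N \<ge> 1 \<Longrightarrow> g \<in> stab N T n v \<Longrightarrow> g \<in> weights N n"
  using xp_monomials_mono[OF phases_subset_nonzero] by (auto simp: stab_eq)

lemma stab_fixes: "N \<ge> 1 \<Longrightarrow> g \<in> stab N T n v \<Longrightarrow> g *\<^sub>v node_vec T n v = node_vec T n v"
  by (simp add: stab_eq)

lemma stab_one: "N \<ge> 1 \<Longrightarrow> 1\<^sub>m (2 ^ n) \<in> stab N T n v"
  using coeff_group.one_mem[OF coeff_group_phases] by (simp add: stab_eq)

lemma stab_mult:
  assumes "N \<ge> 1" "g \<in> stab N T n v" "h \<in> stab N T n v"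
  shows "g * h \<in> stab N T n v"
proof -
  have c: "g \<in> carrier_mat (2 ^ n) (2 ^ n)" "h \<in> carrier_mat (2 ^ n) (2 ^ n)"
    using stab_weights assms xp_monomials_carrier by blast+
  have "(g * h) *\<^sub>v node_vec T n v = g *\<^sub>v (h *\<^sub>v node_vec T n v)"
    by (rule assoc_mult_mat_vec[OF c tvec_carrier])
  then show ?thesis
    using assms coeff_group.mult_mem[OF coeff_group_phases] by (simp add: stab_eq)
qed

lemma stab_append:
  assumes "good_table T" "v \<le> length T"
  shows "stab N (T @ S) n v = stab N T n v"
  using assms by (simp add: stab_def node_tensor_append)

text \<open>The node vector has to be nonzero: on the zero vector all weights agree, and their
  quotient could carry any scalar.\<close>

lemma weights_factor_stab:
  assumes N: "N \<ge> 1" and a: "a \<in> weights N n" and b: "b \<in> weights N n"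
    and nz: "node_vec T n v \<noteq> 0\<^sub>v (2 ^ n)" and eq: "a *\<^sub>v node_vec T n v = b *\<^sub>v node_vec T n v"
  obtains s where "s \<in> stab N T n v" "a = b * s"
proof -
  obtain b' where b': "b' \<in> weights N n" "b' * b = 1\<^sub>m (2 ^ n)" "b * b' = 1\<^sub>m (2 ^ n)"
    using coeff_group.inverse_mem[OF coeff_group_nonzero] N b by blast
  note c = xp_monomials_carrier[OF a] xp_monomials_carrier[OF b] xp_monomials_carrier[OF b'(1)]
  let ?s = "b' * a"
  have "?s *\<^sub>v node_vec T n v = b' *\<^sub>v (b *\<^sub>v node_vec T n v)"
    using assoc_mult_mat_vec[OF c(3,1) tvec_carrier] eq by simp
  also have "\<dots> = node_vec T n v"
    using assoc_mult_mat_vec[OF c(3,2) tvec_carrier] b'(2) one_mult_mat_vec[OF tvec_carrier] by metis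
  finally have s: "?s *\<^sub>v node_vec T n v = node_vec T n v" .
  have "?s \<in> xp_monomials N (phases N) n"
    by (rule weight_fixing_nonzero_vec[OF N weights_mult[OF N b'(1) a] tvec_carrier nz s])
  then have "?s \<in> stab N T n v" using s N by (simp add: stab_eq)
  moreover have "a = b * ?s" using assoc_mult_mat[OF c(2,3,1)] b'(3) c(1) by simp
  ultimately show ?thesis by (rule that)
qed

text \<open>Clearing the inverses gives an equation in which a common left factor of
  \<open>w\<close> and \<open>w'\<close> cancels and stabilizer elements can be collected on the
  right.\<close>

lemma quot_weight_eq_iff:
  assumes N: "N \<ge> 1" and wt: "w \<in> weights N n" "w' \<in> weights N n" "g \<in> weights N n" "g' \<in> weights N n"
    and h: "h \<in> carrier_mat (2 ^ n) (2 ^ n)"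
  shows "h = quot_weight N n k g w w' g' \<longleftrightarrow> w * g * h = inverse (xp_omega N ^ (2 * k)) \<cdot>\<^sub>m (w' * g')"
proof -
  note inv = coeff_group.m_inv_mem[OF coeff_group_nonzero[OF N]]
  define a b where "a = m_inv (op_ring n) g" and "b = m_inv (op_ring n) w"
  have ab: "a \<in> weights N n" "b \<in> weights N n" "a * g = 1\<^sub>m (2 ^ n)" "g * a = 1\<^sub>m (2 ^ n)"
    "b * w = 1\<^sub>m (2 ^ n)" "w * b = 1\<^sub>m (2 ^ n)"
    unfolding a_def b_def using inv[OF wt(3)] inv[OF wt(1)] by auto
  note c = wt[THEN xp_monomials_carrier] ab(1,2)[THEN xp_monomials_carrier]
  note pc = mult_carrier_mat[of _ "2 ^ n" "2 ^ n" _ "2 ^ n"]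
  note assoc = assoc_mult_mat[of _ "2 ^ n" "2 ^ n" _ "2 ^ n" _ "2 ^ n"]
  have wgab: "w * g * (a * b) = 1\<^sub>m (2 ^ n)"
  proof -
    have "w * g * (a * b) = w * ((g * a) * b)" using c by (simp add: assoc pc)
    then show ?thesis using ab c by simp
  qed
  have q: "quot_weight N n k g w w' g' = inverse (xp_omega N ^ (2 * k)) \<cdot>\<^sub>m (a * b * (w' * g'))"
    unfolding quot_weight_def a_def[symmetric] b_def[symmetric] using c by (simp add: assoc pc)
  have wg: "w * g \<in> weights N n" using N wt by (intro weights_mult)
  have "w * g * quot_weight N n k g w w' g' = inverse (xp_omega N ^ (2 * k)) \<cdot>\<^sub>m (w * g * (a * b * (w' * g')))"
    unfolding q using c by (intro mult_smult_distrib[of _ "2 ^ n" "2 ^ n" _ "2 ^ n"]) (auto intro!: pc)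
  also have "w * g * (a * b * (w' * g')) = w * g * (a * b) * (w' * g')"
    using c by (intro assoc[symmetric]) (auto intro!: pc)
  also have "\<dots> = w' * g'" unfolding wgab using c by (intro left_mult_one_mat[of _ _ "2 ^ n"]) (auto intro!: pc)
  finally have key: "w * g * quot_weight N n k g w w' g' = inverse (xp_omega N ^ (2 * k)) \<cdot>\<^sub>m (w' * g')" .
  have "quot_weight N n k g w w' g' \<in> carrier_mat (2 ^ n) (2 ^ n)"
    unfolding q using c by (auto intro!: pc)
  then show ?thesis using key weights_left_cancel[OF N wg h] by metis
qed

lemma quot_weight_mem:
  assumes N: "N \<ge> 1" and wt: "w \<in> weights N n" "w' \<in> weights N n" "g \<in> weights N n" "g' \<in> weights N n"
  shows "quot_weight N n k g w w' g' \<in> weights N n"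
  unfolding quot_weight_def
  using coeff_group.m_inv_mem(1)[OF coeff_group_nonzero[OF N]] wt
  by (intro weights_smult[OF N] weights_mult[OF N]) auto

lemma quot_weights_subset_weights:
  assumes "N \<ge> 1" "w \<in> weights N n" "w' \<in> weights N n"
  shows "quot_weights N T n (w, v) (w', v') \<subseteq> weights N n"
  using quot_weight_mem[OF assms] stab_weights[OF assms(1)] by (auto simp: quot_weights_def)

text \<open>The exponent \<open>k\<close> is replaced by an element \<open>c\<close> of the group of
  even phases, so that further even phases can be multiplied into it.\<close>

lemma mem_quot_weights_iff:
  assumes N: "N \<ge> 1" and wt: "w \<in> weights N n" "w' \<in> weights N n"
  shows "h \<in> quot_weights N T n (w, v) (w', v') \<longleftrightarrow> h \<in> carrier_mat (2 ^ n) (2 ^ n) \<and>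
    (\<exists>c \<in> even_phases N. \<exists>g \<in> stab N T n v. \<exists>g' \<in> stab N T n v'. w * g * h = c \<cdot>\<^sub>m (w' * g'))"
    (is "?L \<longleftrightarrow> ?R")
proof
  assume L: ?L
  then obtain k g g' where k: "h = quot_weight N n k g w w' g'" "g \<in> stab N T n v" "g' \<in> stab N T n v'"
    by (auto simp: quot_weights_def)
  have h: "h \<in> carrier_mat (2 ^ n) (2 ^ n)"
    using L quot_weights_subset_weights[OF assms] xp_monomials_carrier by blast
  have "w * g * h = inverse (xp_omega N ^ (2 * k)) \<cdot>\<^sub>m (w' * g')"
    using k quot_weight_eq_iff[OF N wt stab_weights[OF N k(2)] stab_weights[OF N k(3)] h] by blast
  moreover have "inverse (xp_omega N ^ (2 * k)) \<in> even_phases N"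
    by (rule even_phases_inverse[OF N]) (simp add: even_phases_def)
  ultimately show ?R using h k by blast
next
  assume ?R
  then obtain c g g' where c: "h \<in> carrier_mat (2 ^ n) (2 ^ n)" "c \<in> even_phases N" "g \<in> stab N T n v"
    "g' \<in> stab N T n v'" "w * g * h = c \<cdot>\<^sub>m (w' * g')" by blast
  \<comment> \<open>\<open>quot_weight\<close> divides by its phase, so it is
    \<open>inverse c\<close> that needs an exponent below \<open>N\<close>.\<close>
  obtain k where k: "k < N" "inverse c = xp_omega N ^ (2 * k)"
    using even_phases_inverse[OF N c(2)] by (auto simp: even_phases_eq[OF N])
  then have "c = inverse (xp_omega N ^ (2 * k))" by (metis inverse_inverse_eq)
  then have "h = quot_weight N n k g w w' g'"
    using c quot_weight_eq_iff[OF N wt stab_weights[OF N c(3)] stab_weights[OF N c(4)] c(1)] by blast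
  then show ?L using k c by (auto simp: quot_weights_def)
qed

text \<open>The hypotheses give w = M u s and w' = d M u' s' with s, s' in the stabilizers. In w g h
  = e w' g' the factor M cancels, d joins the phase e, and s, s' join g, g'. What remains says that
  h is a candidate for u, u'.\<close>

lemma quot_weights_subset:
  assumes N: "N \<ge> 1"
    and wt: "w \<in> weights N n" "w' \<in> weights N n" "u \<in> weights N n" "u' \<in> weights N n" "M \<in> weights N n"
    and d: "d \<in> even_phases N"
    and nz: "node_vec T n v \<noteq> 0\<^sub>v (2 ^ n)" "node_vec T n v' \<noteq> 0\<^sub>v (2 ^ n)"
    and eq: "w *\<^sub>v node_vec T n v = M *\<^sub>v (u *\<^sub>v node_vec T n v)"
    and eq': "w' *\<^sub>v node_vec T n v' = d \<cdot>\<^sub>v (M *\<^sub>v (u' *\<^sub>v node_vec T n v'))"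
  shows "quot_weights N T n (w, v) (w', v') \<subseteq> quot_weights N T n (u, v) (u', v')"
proof
  note c = wt[THEN xp_monomials_carrier]
  note pc = mult_carrier_mat[of _ "2 ^ n" "2 ^ n" _ "2 ^ n"]
  note assoc = assoc_mult_mat[of _ "2 ^ n" "2 ^ n" _ "2 ^ n" _ "2 ^ n"]
  have "w *\<^sub>v node_vec T n v = (M * u) *\<^sub>v node_vec T n v"
    using eq assoc_mult_mat_vec[OF c(5,3) tvec_carrier] by metis
  then obtain s where s: "s \<in> stab N T n v" "w = M * u * s"
    using weights_factor_stab[OF N wt(1) weights_mult[OF N wt(5,3)] nz(1)] by blast
  have "w' *\<^sub>v node_vec T n v' = (d \<cdot>\<^sub>m (M * u')) *\<^sub>v node_vec T n v'"
    using eq' assoc_mult_mat_vec[OF c(5,4) tvec_carrier, of "node_tensor T n v'"] c(4)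
    by (subst smult_mat_mult_vec) simp_all
  then obtain s' where s': "s' \<in> stab N T n v'" "w' = d \<cdot>\<^sub>m (M * u') * s'"
    using weights_factor_stab[OF N wt(2) weights_smult[OF N weights_mult[OF N wt(5,4)]] nz(2)]
      even_phases_nonzero[OF d] by blast
  fix h assume "h \<in> quot_weights N T n (w, v) (w', v')"
  then obtain e g g' where h: "h \<in> carrier_mat (2 ^ n) (2 ^ n)" "e \<in> even_phases N" "g \<in> stab N T n v"
    "g' \<in> stab N T n v'" "w * g * h = e \<cdot>\<^sub>m (w' * g')"
    unfolding mem_quot_weights_iff[OF N wt(1,2)] by blast
  have sc: "s \<in> carrier_mat (2 ^ n) (2 ^ n)" "s' \<in> carrier_mat (2 ^ n) (2 ^ n)"
    "g \<in> carrier_mat (2 ^ n) (2 ^ n)" "g' \<in> carrier_mat (2 ^ n) (2 ^ n)"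
    using stab_weights[OF N] s(1) s'(1) h(3,4) xp_monomials_carrier by blast+
  note ms = mult_smult_assoc_mat[of _ "2 ^ n" "2 ^ n" _ "2 ^ n"]
  have "M * (u * (s * g) * h) = w * g * h" unfolding s using c sc h(1) by (simp add: assoc pc)
  also have "\<dots> = e \<cdot>\<^sub>m (d \<cdot>\<^sub>m (M * u') * s' * g')" using h(5) s'(2) by simp
  also have "d \<cdot>\<^sub>m (M * u') * s' = d \<cdot>\<^sub>m (M * u' * s')" using c sc by (intro ms) (auto intro!: pc)
  also have "d \<cdot>\<^sub>m (M * u' * s') * g' = d \<cdot>\<^sub>m (M * u' * s' * g')" using c sc by (intro ms) (auto intro!: pc)
  also have "M * u' * s' * g' = M * (u' * (s' * g'))" using c sc by (simp add: assoc pc)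
  also have "e \<cdot>\<^sub>m (d \<cdot>\<^sub>m (M * (u' * (s' * g')))) = M * ((e * d) \<cdot>\<^sub>m (u' * (s' * g')))"
    unfolding smult_smult_mat
    by (rule mult_smult_distrib[symmetric, OF c(5) pc[OF c(4) pc[OF sc(2,4)]]])
  finally have "M * (u * (s * g) * h) = M * ((e * d) \<cdot>\<^sub>m (u' * (s' * g')))" .
  from weights_left_cancel[OF N wt(5) pc[OF pc[OF c(3) pc[OF sc(1,3)]] h(1)]
      smult_carrier_mat[OF pc[OF c(4) pc[OF sc(2,4)]]] this]
  have "u * (s * g) * h = (e * d) \<cdot>\<^sub>m (u' * (s' * g'))" .
  moreover have "e * d \<in> even_phases N" by (rule even_phases_mult[OF h(2) d])
  moreover have "s * g \<in> stab N T n v" "s' * g' \<in> stab N T n v'"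
    using stab_mult[OF N] s(1) s'(1) h(3,4) by blast+
  ultimately show "h \<in> quot_weights N T n (u, v) (u', v')"
    unfolding mem_quot_weights_iff[OF N wt(3,4)] using h(1) by blast
qed

text \<open>The hypotheses are symmetric: the inverses of \<open>M\<close> and \<open>d\<close>
  exchange the roles of the two pairs of edges.\<close>

lemma quot_weights_eq:
  assumes N: "N \<ge> 1"
    and wt: "w \<in> weights N n" "w' \<in> weights N n" "u \<in> weights N n" "u' \<in> weights N n" "M \<in> weights N n"
    and d: "d \<in> even_phases N"
    and nz: "node_vec T n v \<noteq> 0\<^sub>v (2 ^ n)" "node_vec T n v' \<noteq> 0\<^sub>v (2 ^ n)"
    and eq: "w *\<^sub>v node_vec T n v = M *\<^sub>v (u *\<^sub>v node_vec T n v)"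
    and eq': "w' *\<^sub>v node_vec T n v' = d \<cdot>\<^sub>v (M *\<^sub>v (u' *\<^sub>v node_vec T n v'))"
  shows "quot_weights N T n (w, v) (w', v') = quot_weights N T n (u, v) (u', v')"
proof
  show "quot_weights N T n (w, v) (w', v') \<subseteq> quot_weights N T n (u, v) (u', v')"
    by (rule quot_weights_subset[OF assms])
  obtain L where L: "L \<in> weights N n" "L * M = 1\<^sub>m (2 ^ n)"
    using coeff_group.inverse_mem[OF coeff_group_nonzero[OF N] wt(5)] by blast
  have LM: "L *\<^sub>v (M *\<^sub>v x) = x" if "x \<in> carrier_vec (2 ^ n)" for x
    using assoc_mult_mat_vec[OF xp_monomials_carrier[OF L(1)] xp_monomials_carrier[OF wt(5)] that] L(2) that by simp
  note mv = mat_vec_carrier[OF xp_monomials_carrier]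
  have 1: "u *\<^sub>v node_vec T n v = L *\<^sub>v (w *\<^sub>v node_vec T n v)"
    unfolding eq by (rule LM[symmetric, OF mv[OF wt(3)]])
  have "L *\<^sub>v (w' *\<^sub>v node_vec T n v') = d \<cdot>\<^sub>v (L *\<^sub>v (M *\<^sub>v (u' *\<^sub>v node_vec T n v')))"
    unfolding eq' by (rule mult_mat_vec[OF xp_monomials_carrier[OF L(1)] mv[OF wt(5)]])
  also have "\<dots> = d \<cdot>\<^sub>v (u' *\<^sub>v node_vec T n v')" by (simp only: LM[OF mv[OF wt(4)]])
  finally have 2: "u' *\<^sub>v node_vec T n v' = inverse d \<cdot>\<^sub>v (L *\<^sub>v (w' *\<^sub>v node_vec T n v'))"
    using even_phases_nonzero[OF d] by (simp add: smult_smult_assoc)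
  show "quot_weights N T n (u, v) (u', v') \<subseteq> quot_weights N T n (w, v) (w', v')"
    by (rule quot_weights_subset[OF N wt(3,4,1,2) L(1) even_phases_inverse[OF N d] nz 1 2])
qed

lemma quot_weights_append:
  assumes "good_table T" "v \<le> length T" "v' \<le> length T"
  shows "quot_weights N (T @ S) n (w, v) (w', v') = quot_weights N T n (w, v) (w', v')"
  using assms by (simp add: quot_weights_def stab_append)

lemma high_candidates_append:
  assumes "good_table T" "v \<le> length T" "v' \<le> length T"
  shows "high_candidates N (T @ S) n (w, v) (w', v') = high_candidates N T n (w, v) (w', v')"
  using assms by (simp add: high_candidates_def quot_weights_append)

text \<open>This symmetry is why an X on the top index does not change the node.\<close>

lemma high_candidates_commute: "high_candidates N T n e e' = high_candidates N T n e' e"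
  by (auto simp: high_candidates_def)

section \<open>Normalization and canonicity\<close>

text \<open>The invariant of an edge that represents the vector \<open>x\<close>. A zero vector gets
  its own clause because the zero matrix is not in \<open>weights\<close>; its edge is fixed
  completely.\<close>

definition edge_ok :: "nat \<Rightarrow> table \<Rightarrow> nat \<Rightarrow> complex vec \<Rightarrow> complex mat \<Rightarrow> nat \<Rightarrow> bool" where
  "edge_ok N T n x w v \<longleftrightarrow> v \<le> length T \<and> x = w *\<^sub>v node_vec T n v \<and>
     (x = 0\<^sub>v (2 ^ n) \<longrightarrow> w = 0\<^sub>m (2 ^ n) (2 ^ n) \<and> v = 0) \<and>
     (x \<noteq> 0\<^sub>v (2 ^ n) \<longrightarrow> w \<in> weights N n)"

lemma edge_okD:
  assumes "edge_ok N T n x w v"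
  shows "v \<le> length T" "x = w *\<^sub>v node_vec T n v"
    "x = 0\<^sub>v (2 ^ n) \<Longrightarrow> w = 0\<^sub>m (2 ^ n) (2 ^ n)" "x \<noteq> 0\<^sub>v (2 ^ n) \<Longrightarrow> w \<in> weights N n"
  using assms unfolding edge_ok_def by blast+

lemma edge_ok_append:
  assumes "good_table T" "edge_ok N T n x w v"
  shows "edge_ok N (T @ S) n x w v"
proof -
  note v = edge_okD(1)[OF assms(2)]
  have "v \<le> length (T @ S)" using v by simp
  then show ?thesis using assms(2) unfolding edge_ok_def node_tensor_append[OF assms(1) v] by blast
qed

lemma edge_ok_zero_iff:
  assumes "N \<ge> 1" "edge_ok N T n x w v"
  shows "w = 0\<^sub>m (2 ^ n) (2 ^ n) \<longleftrightarrow> x = 0\<^sub>v (2 ^ n)"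
  using edge_okD(3,4)[OF assms(2)] weight_nonzero[OF assms(1)] by blast

lemma edge_ok_weight:
  assumes "N \<ge> 1" "edge_ok N T n x w v" "w \<noteq> 0\<^sub>m (2 ^ n) (2 ^ n)"
  shows "w \<in> weights N n" "node_vec T n v \<noteq> 0\<^sub>v (2 ^ n)"
proof -
  have x: "x \<noteq> 0\<^sub>v (2 ^ n)" using assms edge_ok_zero_iff[OF assms(1,2)] by blast
  show w: "w \<in> weights N n" by (rule edge_okD(4)[OF assms(2) x])
  show "node_vec T n v \<noteq> 0\<^sub>v (2 ^ n)"
    using x edge_okD(2)[OF assms(2)] weights_mult_vec_eq_0_iff[OF assms(1) w tvec_carrier] by blast
qed

section \<open>Soundness of normalization and building\<close>

lemma zero_mat_mult_vec: "0\<^sub>m m k *\<^sub>v x = (0\<^sub>v m :: complex vec)" if "x \<in> carrier_vec k"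
  using that by (intro eq_vecI) auto

text \<open>\<open>b\<close> says that the nonzero slice is the one at 1. A half node keeps its
  nonzero edge low over the terminal node and high otherwise; X is applied exactly when the two
  positions disagree.\<close>

lemma half_node_sound:
  assumes N: "N \<ge> 1" and w: "w \<in> weights N n" and u: "u = half_node n v"
    and kr: "K = kron (phase_mat (if v = 0 then b else \<not> b) 1) w"
  shows "K \<in> weights N (Suc n)" "node_index u = Suc n" "low u \<in> {0, v}" "high u \<in> {0, v}"
    "low_weight u \<in> carrier_mat (2 ^ n) (2 ^ n)" "high_weight u \<in> carrier_mat (2 ^ n) (2 ^ n)"
    "K *\<^sub>v ((low_weight u *\<^sub>v node_vec T n (low u)) @\<^sub>v (high_weight u *\<^sub>v node_vec T n (high u))) =
      (if b then 0\<^sub>v (2 ^ n) @\<^sub>v (w *\<^sub>v node_vec T n v) else (w *\<^sub>v node_vec T n v) @\<^sub>v 0\<^sub>v (2 ^ n))"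
proof -
  have wc: "w \<in> carrier_mat (2 ^ n) (2 ^ n)" by (rule xp_monomials_carrier[OF w])
  have w0: "w *\<^sub>v 0\<^sub>v (2 ^ n) = 0\<^sub>v (2 ^ n)" using wc by auto
  have s: "1 \<cdot>\<^sub>v x = x" for x :: "complex vec" by simp
  show "K \<in> weights N (Suc n)" unfolding kr using w by (intro xp_monomials_kronI) simp_all
  show "node_index u = Suc n" "low u \<in> {0, v}" "high u \<in> {0, v}"
    "low_weight u \<in> carrier_mat (2 ^ n) (2 ^ n)" "high_weight u \<in> carrier_mat (2 ^ n) (2 ^ n)"
    by (simp_all add: u half_node_def)
  show "K *\<^sub>v ((low_weight u *\<^sub>v node_vec T n (low u)) @\<^sub>v (high_weight u *\<^sub>v node_vec T n (high u))) =
      (if b then 0\<^sub>v (2 ^ n) @\<^sub>v (w *\<^sub>v node_vec T n v) else (w *\<^sub>v node_vec T n v) @\<^sub>v 0\<^sub>v (2 ^ n))"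
    unfolding u kr half_node_def
    by (auto simp: zero_mat_mult_vec[OF tvec_carrier] kron_phase_mat_vec[OF wc] w0 s)
qed

text \<open>\<open>K\<close> applies w g to both slices and the phase \<omega>^(2k) to the high one.
  On the low slice g fixes the node vector; on the high slice the phase and w g h multiply to w' g',
  and g' fixes the node vector.\<close>

lemma split_node_sound:
  assumes N: "N \<ge> 1" and wt: "w \<in> weights N n" "w' \<in> weights N n"
    and g: "g \<in> stab N T n v" "g' \<in> stab N T n v'"
    and h: "h = quot_weight N n k g w w' g'"
    and K: "K = kron (phase_mat b (xp_omega N ^ (2 * k))) (w * g)"
  shows "K \<in> weights N (Suc n)" "h \<in> carrier_mat (2 ^ n) (2 ^ n)"
    "K *\<^sub>v ((1\<^sub>m (2 ^ n) *\<^sub>v node_vec T n v) @\<^sub>v (h *\<^sub>v node_vec T n v')) =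
      (if b then (w' *\<^sub>v node_vec T n v') @\<^sub>v (w *\<^sub>v node_vec T n v)
       else (w *\<^sub>v node_vec T n v) @\<^sub>v (w' *\<^sub>v node_vec T n v'))"
proof -
  note gw = stab_weights[OF N g(1)] stab_weights[OF N g(2)]
  have wg: "w * g \<in> weights N n" by (rule weights_mult[OF N wt(1) gw(1)])
  show "K \<in> weights N (Suc n)" unfolding K using wg by (intro xp_monomials_kronI) (simp_all add: even_phases_def)
  show hc: "h \<in> carrier_mat (2 ^ n) (2 ^ n)"
    unfolding h by (rule xp_monomials_carrier[OF quot_weight_mem[OF N wt gw]])
  have wgh: "w * g * h = inverse (xp_omega N ^ (2 * k)) \<cdot>\<^sub>m (w' * g')"
    using quot_weight_eq_iff[OF N wt gw hc] h by blast
  note c = wt[THEN xp_monomials_carrier] gw[THEN xp_monomials_carrier] xp_monomials_carrier[OF wg]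
  have 1: "(w * g) *\<^sub>v node_vec T n v = w *\<^sub>v node_vec T n v"
    using assoc_mult_mat_vec[OF c(1,3) tvec_carrier] stab_fixes[OF N g(1)] by metis
  have 2: "(w' * g') *\<^sub>v node_vec T n v' = w' *\<^sub>v node_vec T n v'"
    using assoc_mult_mat_vec[OF c(2,4) tvec_carrier] stab_fixes[OF N g(2)] by metis
  have "(w * g) *\<^sub>v (h *\<^sub>v node_vec T n v') = (w * g * h) *\<^sub>v node_vec T n v'"
    by (rule assoc_mult_mat_vec[OF c(5) hc tvec_carrier, symmetric])
  also have "\<dots> = inverse (xp_omega N ^ (2 * k)) \<cdot>\<^sub>v (w' *\<^sub>v node_vec T n v')"
    unfolding wgh using c(4) 2 by (subst smult_mat_mult_vec) simp_all
  finally have 3: "xp_omega N ^ (2 * k) \<cdot>\<^sub>v ((w * g) *\<^sub>v (h *\<^sub>v node_vec T n v')) = w' *\<^sub>v node_vec T n v'"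
    by (simp add: smult_smult_assoc)
  show "K *\<^sub>v ((1\<^sub>m (2 ^ n) *\<^sub>v node_vec T n v) @\<^sub>v (h *\<^sub>v node_vec T n v')) =
      (if b then (w' *\<^sub>v node_vec T n v') @\<^sub>v (w *\<^sub>v node_vec T n v)
       else (w *\<^sub>v node_vec T n v) @\<^sub>v (w' *\<^sub>v node_vec T n v'))"
    unfolding K one_mult_mat_vec[OF tvec_carrier]
      kron_phase_mat_vec[OF c(5) tvec_carrier mat_vec_carrier[OF hc]] 1 3 ..
qed

lemma normalize_sound:
  assumes N: "N \<ge> 1" and nrm: "normalize N T n (w\<^sub>0, v\<^sub>0) (w\<^sub>1, v\<^sub>1) w u"
    and e: "edge_ok N T n x\<^sub>0 w\<^sub>0 v\<^sub>0" "edge_ok N T n x\<^sub>1 w\<^sub>1 v\<^sub>1"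
  shows "w \<in> weights N (Suc n) \<and> node_index u = Suc n \<and> low u \<le> length T \<and> high u \<le> length T \<and>
    low_weight u \<in> carrier_mat (2 ^ n) (2 ^ n) \<and> high_weight u \<in> carrier_mat (2 ^ n) (2 ^ n) \<and>
    w *\<^sub>v ((low_weight u *\<^sub>v node_vec T n (low u)) @\<^sub>v (high_weight u *\<^sub>v node_vec T n (high u))) = x\<^sub>0 @\<^sub>v x\<^sub>1"
proof -
  have x: "x\<^sub>0 = w\<^sub>0 *\<^sub>v node_vec T n v\<^sub>0" "x\<^sub>1 = w\<^sub>1 *\<^sub>v node_vec T n v\<^sub>1" "v\<^sub>0 \<le> length T" "v\<^sub>1 \<le> length T"
    using edge_okD(1,2)[OF e(1)] edge_okD(1,2)[OF e(2)] by blast+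
  note wt = edge_ok_weight(1)[OF N e(1)] edge_ok_weight(1)[OF N e(2)]
  note zero = edge_ok_zero_iff[OF N e(1)] edge_ok_zero_iff[OF N e(2)]
  have XP: "pauli_X * phase_P N ^\<^sub>m k = phase_mat True (xp_omega N ^ (2 * k))" for k
    by (simp add: pauli_X_eq phase_P_pow phase_mat_mult)
  from nrm show ?thesis
  proof cases
    case (keep k g\<^sub>0 g\<^sub>1 h)
    show ?thesis
      using split_node_sound[OF N wt(1)[OF keep(3)] wt(2)[OF keep(4)] keep(7,8,9), of w False] keep(1) x
      by (simp add: phase_P_pow keep(2))
  next
    \<comment> \<open>The two edges exchange roles, and the X in the incoming weight puts the slices
      back in order.\<close>
    case (swap k g\<^sub>0 g\<^sub>1 h)
    show ?thesis
      using split_node_sound[OF N wt(2)[OF swap(4)] wt(1)[OF swap(3)] swap(8,7,9), of w True] swap(1) x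
      by (simp add: XP swap(2))
  next
    case high_zero
    have "w = kron (phase_mat (if v\<^sub>0 = 0 then False else \<not> False) 1) w\<^sub>0"
      using high_zero(1) by (simp add: pauli_X_pow)
    note half = half_node_sound[OF N wt(1)[OF high_zero(3)] high_zero(2) this]
    show ?thesis using half(1-6) half(7)[of T] x(1,3) zero(2) high_zero(4) by auto
  next
    case low_zero
    have "w = kron (phase_mat (if v\<^sub>1 = 0 then True else \<not> True) 1) w\<^sub>1"
      using low_zero(1) by (simp add: pauli_X_pow)
    note half = half_node_sound[OF N wt(2)[OF low_zero(4)] low_zero(2) this]
    show ?thesis using half(1-6) half(7)[of T] x(2,4) zero(1) low_zero(3) by auto
  qed
qed

lemma build_sound:
  assumes N: "N \<ge> 1" and "build N n \<phi> T T' w v" "good_table T"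
  shows "good_table T' \<and> (\<exists>S. T' = T @ S) \<and> edge_ok N T' n (tvec n \<phi>) w v"
  using assms(2,3)
proof induction
  case (zero n \<phi> T)
  then show ?case unfolding edge_ok_def zero_mat_mult_vec[OF tvec_carrier] by simp
next
  case (terminal \<phi> T)
  have "tvec 0 \<phi> $ 0 \<noteq> 0\<^sub>v 1 $ 0" using terminal by (simp add: tvec_def)
  then have "tvec 0 \<phi> \<noteq> 0\<^sub>v (2 ^ 0)" by auto
  moreover have "tvec 0 \<phi> = (\<phi> [] \<cdot>\<^sub>m 1\<^sub>m 1) *\<^sub>v node_vec T 0 0"
    by (rule eq_vecI) (simp_all add: tvec_def scalar_prod_def)
  moreover have "\<phi> [] \<cdot>\<^sub>m 1\<^sub>m 1 \<in> weights N 0" using terminal by auto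
  ultimately have "edge_ok N T 0 (tvec 0 \<phi>) (\<phi> [] \<cdot>\<^sub>m 1\<^sub>m 1) 0" unfolding edge_ok_def by blast
  then show ?case using terminal by simp
next
  case (branch n \<phi> T T\<^sub>0 w\<^sub>0 v\<^sub>0 T\<^sub>1 w\<^sub>1 v\<^sub>1 w u T\<^sub>2 v)
  obtain S where T0: "good_table T\<^sub>0" "T\<^sub>0 = T @ S" "edge_ok N T\<^sub>0 n (tvec n (slice False \<phi>)) w\<^sub>0 v\<^sub>0"
    using branch by blast
  then obtain S' where T1: "good_table T\<^sub>1" "T\<^sub>1 = T\<^sub>0 @ S'" "edge_ok N T\<^sub>1 n (tvec n (slice True \<phi>)) w\<^sub>1 v\<^sub>1"
    using branch by blast
  \<comment> \<open>The low edge was established before the high slice was built; it stays valid in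
    the larger table.\<close>
  have e0: "edge_ok N T\<^sub>1 n (tvec n (slice False \<phi>)) w\<^sub>0 v\<^sub>0"
    unfolding T1(2) by (rule edge_ok_append[OF T0(1,3)])
  note u = normalize_sound[OF N branch.hyps(4) e0 T1(3)]
  have lh: "low u \<le> length T\<^sub>1" "high u \<le> length T\<^sub>1" using u by auto
  note T2 = intern_good_table[OF T1(1) branch.hyps(5) lh]
  obtain S'' where S'': "T\<^sub>2 = T\<^sub>1 @ S''" using T2(2) by blast
  have "node_vec T\<^sub>2 (Suc n) v =
      (low_weight u *\<^sub>v node_vec T\<^sub>1 n (low u)) @\<^sub>v (high_weight u *\<^sub>v node_vec T\<^sub>1 n (high u))"
    using node_vec_Suc[OF T2(3,5)] u node_tensor_append[OF T1(1) lh(1)] node_tensor_append[OF T1(1) lh(2)]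
    by (simp only: S'')
  then have "tvec (Suc n) \<phi> = w *\<^sub>v node_vec T\<^sub>2 (Suc n) v" using u by (simp only: tvec_Suc)
  then have "edge_ok N T\<^sub>2 (Suc n) (tvec (Suc n) \<phi>) w v"
    unfolding edge_ok_def using branch.hyps(1) u T2(4) by blast
  then show ?case using T2(1) S'' T1(2) T0(2) by simp
qed

lemma table_step_good:
  assumes "N \<ge> 1" "(table_step N)\<^sup>*\<^sup>* T T'" "good_table T"
  shows "good_table T' \<and> (\<exists>S. T' = T @ S)"
  using assms(2,3)
proof induction
  case (step T' T'')
  then obtain n \<phi> w v where "build N n \<phi> T' T'' w v" by (auto simp: table_step_def)
  from build_sound[OF assms(1) this] step show ?case by auto
qed simp

text \<open>Keeps from \<open>normalize\<close> only what determines the node, forgetting the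
  incoming weight and the choice of k and of the stabilizer elements. With \<open>min\<close> and
  \<open>max\<close> the rules for keeping and swapping become one.\<close>

definition normal_node :: "nat \<Rightarrow> table \<Rightarrow> nat \<Rightarrow> edge \<Rightarrow> edge \<Rightarrow> node \<Rightarrow> bool" where
  "normal_node N T n = (\<lambda>(w\<^sub>0, v\<^sub>0) (w\<^sub>1, v\<^sub>1) u.
     if w\<^sub>0 = 0\<^sub>m (2 ^ n) (2 ^ n) then u = half_node n v\<^sub>1
     else if w\<^sub>1 = 0\<^sub>m (2 ^ n) (2 ^ n) then u = half_node n v\<^sub>0
     else \<exists>h. smallest_weight N n (high_candidates N T n (w\<^sub>0, v\<^sub>0) (w\<^sub>1, v\<^sub>1)) h \<and>
       u = Node (Suc n) (1\<^sub>m (2 ^ n)) (min v\<^sub>0 v\<^sub>1) h (max v\<^sub>0 v\<^sub>1))"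

lemma normalize_normal_node:
  "normalize N T n (w\<^sub>0, v\<^sub>0) (w\<^sub>1, v\<^sub>1) w u \<Longrightarrow> normal_node N T n (w\<^sub>0, v\<^sub>0) (w\<^sub>1, v\<^sub>1) u"
  by (erule normalize.cases) (auto simp: normal_node_def min_def max_def)

lemma normal_node_append:
  assumes "good_table T" "v\<^sub>0 \<le> length T" "v\<^sub>1 \<le> length T" "normal_node N T n (w\<^sub>0, v\<^sub>0) (w\<^sub>1, v\<^sub>1) u"
  shows "normal_node N (T @ S) n (w\<^sub>0, v\<^sub>0) (w\<^sub>1, v\<^sub>1) u"
  using assms by (simp add: normal_node_def high_candidates_append)

text \<open>Two zero edges are excluded because the first case of \<open>normal_node\<close> would
  then read off a different child after the exchange.\<close>

lemma normal_node_swap: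
  assumes "normal_node N T n (w\<^sub>0, v\<^sub>0) (w\<^sub>1, v\<^sub>1) u"
    and "w\<^sub>0 \<noteq> 0\<^sub>m (2 ^ n) (2 ^ n) \<or> w\<^sub>1 \<noteq> 0\<^sub>m (2 ^ n) (2 ^ n)"
  shows "normal_node N T n (w\<^sub>1, v\<^sub>1) (w\<^sub>0, v\<^sub>0) u"
  using assms high_candidates_commute[of N T n "(w\<^sub>0, v\<^sub>0)" "(w\<^sub>1, v\<^sub>1)"]
  by (auto simp: normal_node_def min.commute max.commute split: if_splits)

lemma high_candidates_subset_weights:
  assumes "N \<ge> 1" "w\<^sub>0 \<in> weights N n" "w\<^sub>1 \<in> weights N n"
  shows "high_candidates N T n (w\<^sub>0, v\<^sub>0) (w\<^sub>1, v\<^sub>1) \<subseteq> weights N n"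
  using quot_weights_subset_weights[OF assms] quot_weights_subset_weights[OF assms(1,3,2)]
  by (auto simp: high_candidates_def)

text \<open>The order of the nodes decides which quotient is formed, so both are compared. In the
  opposite one the second slice is the reference: \<open>M\<close> is replaced by \<open>d\<close>
  times \<open>M\<close>, and \<open>d\<close> by its inverse.\<close>

lemma high_candidates_eq:
  assumes N: "N \<ge> 1"
    and wt: "w \<in> weights N n" "w' \<in> weights N n" "u \<in> weights N n" "u' \<in> weights N n" "M \<in> weights N n"
    and d: "d \<in> even_phases N"
    and nz: "node_vec T n v \<noteq> 0\<^sub>v (2 ^ n)" "node_vec T n v' \<noteq> 0\<^sub>v (2 ^ n)"
    and eq: "w *\<^sub>v node_vec T n v = M *\<^sub>v (u *\<^sub>v node_vec T n v)"
    and eq': "w' *\<^sub>v node_vec T n v' = d \<cdot>\<^sub>v (M *\<^sub>v (u' *\<^sub>v node_vec T n v'))"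
  shows "high_candidates N T n (w, v) (w', v') = high_candidates N T n (u, v) (u', v')"
proof -
  note dnz = even_phases_nonzero[OF d]
  have sm: "(d \<cdot>\<^sub>m M) *\<^sub>v x = d \<cdot>\<^sub>v (M *\<^sub>v x)" if "x \<in> carrier_vec (2 ^ n)" for x
    using that xp_monomials_carrier[OF wt(5)] by (intro smult_mat_mult_vec) simp
  note mv = mat_vec_carrier[OF xp_monomials_carrier]
  have 1: "w' *\<^sub>v node_vec T n v' = (d \<cdot>\<^sub>m M) *\<^sub>v (u' *\<^sub>v node_vec T n v')"
    using eq' sm[OF mv[OF wt(4)]] by simp
  have 2: "w *\<^sub>v node_vec T n v = inverse d \<cdot>\<^sub>v ((d \<cdot>\<^sub>m M) *\<^sub>v (u *\<^sub>v node_vec T n v))"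
    unfolding eq sm[OF mv[OF wt(3)]] using dnz by (simp add: smult_smult_assoc)
  show ?thesis
    using quot_weights_eq[OF assms]
      quot_weights_eq[OF N wt(2,1,4,3) weights_smult[OF N wt(5) dnz] even_phases_inverse[OF N d] nz(2,1) 1 2]
    by (simp only: high_candidates_def snd_conv)
qed

text \<open>Invertibility of \<open>M\<close> and \<open>d\<close> preserves which slices vanish, so
  both nodes fall under the same case. Half nodes depend only on the child; otherwise both high
  weights are the minimum of one set.\<close>

lemma normal_node_unique:
  assumes N: "N \<ge> 1" and M: "M \<in> weights N n" and d: "d \<in> even_phases N"
    and e: "edge_ok N T n x\<^sub>0 w\<^sub>0 v\<^sub>0" "edge_ok N T n x\<^sub>1 w\<^sub>1 v\<^sub>1"
    and f: "edge_ok N T n y\<^sub>0 u\<^sub>0 v\<^sub>0" "edge_ok N T n y\<^sub>1 u\<^sub>1 v\<^sub>1"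
    and x: "x\<^sub>0 = M *\<^sub>v y\<^sub>0" "x\<^sub>1 = d \<cdot>\<^sub>v (M *\<^sub>v y\<^sub>1)"
    and nodes: "normal_node N T n (w\<^sub>0, v\<^sub>0) (w\<^sub>1, v\<^sub>1) a" "normal_node N T n (u\<^sub>0, v\<^sub>0) (u\<^sub>1, v\<^sub>1) b"
    and y: "y\<^sub>0 \<in> carrier_vec (2 ^ n)" "y\<^sub>1 \<in> carrier_vec (2 ^ n)"
  shows "a = b"
proof -
  have z0: "w\<^sub>0 = 0\<^sub>m (2 ^ n) (2 ^ n) \<longleftrightarrow> u\<^sub>0 = 0\<^sub>m (2 ^ n) (2 ^ n)"
    using edge_ok_zero_iff[OF N e(1)] edge_ok_zero_iff[OF N f(1)]
      weights_mult_vec_eq_0_iff[OF N M y(1)] x(1) by simp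
  have "x\<^sub>1 = (d \<cdot>\<^sub>m M) *\<^sub>v y\<^sub>1"
    unfolding x using y(2) xp_monomials_carrier[OF M] by (intro smult_mat_mult_vec[symmetric]) simp
  then have z1: "w\<^sub>1 = 0\<^sub>m (2 ^ n) (2 ^ n) \<longleftrightarrow> u\<^sub>1 = 0\<^sub>m (2 ^ n) (2 ^ n)"
    using edge_ok_zero_iff[OF N e(2)] edge_ok_zero_iff[OF N f(2)]
      weights_mult_vec_eq_0_iff[OF N weights_smult[OF N M even_phases_nonzero[OF d]] y(2)] by simp
  show ?thesis
  proof (cases "w\<^sub>0 = 0\<^sub>m (2 ^ n) (2 ^ n) \<or> w\<^sub>1 = 0\<^sub>m (2 ^ n) (2 ^ n)")
    case True
    then show ?thesis using nodes z0 z1 by (auto simp: normal_node_def)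
  next
    case False
    then have nz: "w\<^sub>0 \<noteq> 0\<^sub>m (2 ^ n) (2 ^ n)" "w\<^sub>1 \<noteq> 0\<^sub>m (2 ^ n) (2 ^ n)"
      "u\<^sub>0 \<noteq> 0\<^sub>m (2 ^ n) (2 ^ n)" "u\<^sub>1 \<noteq> 0\<^sub>m (2 ^ n) (2 ^ n)" using z0 z1 by auto
    note w = edge_ok_weight[OF N e(1) nz(1)] edge_ok_weight[OF N e(2) nz(2)]
      edge_ok_weight[OF N f(1) nz(3)] edge_ok_weight[OF N f(2) nz(4)]
    have "w\<^sub>0 *\<^sub>v node_vec T n v\<^sub>0 = M *\<^sub>v (u\<^sub>0 *\<^sub>v node_vec T n v\<^sub>0)"
      "w\<^sub>1 *\<^sub>v node_vec T n v\<^sub>1 = d \<cdot>\<^sub>v (M *\<^sub>v (u\<^sub>1 *\<^sub>v node_vec T n v\<^sub>1))"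
      using edge_okD(2)[OF e(1)] edge_okD(2)[OF f(1)] edge_okD(2)[OF e(2)] edge_okD(2)[OF f(2)] x by metis+
    from high_candidates_eq[OF N w(1,3,5,7) M d w(2,4) this]
    show ?thesis
      using nodes nz smallest_weight_unique[OF N high_candidates_subset_weights[OF N w(5,7)]]
      by (auto simp: normal_node_def)
  qed
qed

section \<open>Canonicity of the root node\<close>

lemma build_zero_node: "build N n \<phi> T T' w v \<Longrightarrow> tvec n \<phi> = 0\<^sub>v (2 ^ n) \<Longrightarrow> v = 0"
  by (erule build.cases) auto

lemma build_level_0_node: "build N 0 \<phi> T T' w v \<Longrightarrow> v = 0"
  by (erule build.cases) auto

text \<open>Inverts the branching rule and moves every fact about the intermediate tables to the
  final table \<open>T\<close>, where two independent builds can be compared.\<close>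

lemma build_Suc_cases:
  assumes N: "N \<ge> 1" and b: "build N (Suc n) \<phi> T\<^sub>0 T\<^sub>1 w r" and nz: "tvec (Suc n) \<phi> \<noteq> 0\<^sub>v (2 ^ Suc n)"
    and T: "good_table T\<^sub>0" "T = T\<^sub>1 @ S"
  obtains T\<^sub>a w\<^sub>0 v\<^sub>0 T\<^sub>b w\<^sub>1 v\<^sub>1 S\<^sub>a S\<^sub>b where
    "build N n (slice False \<phi>) T\<^sub>0 T\<^sub>a w\<^sub>0 v\<^sub>0" "build N n (slice True \<phi>) T\<^sub>a T\<^sub>b w\<^sub>1 v\<^sub>1"
    "good_table T\<^sub>a" "T = T\<^sub>a @ S\<^sub>a" "T = T\<^sub>b @ S\<^sub>b"
    "edge_ok N T n (tvec n (slice False \<phi>)) w\<^sub>0 v\<^sub>0" "edge_ok N T n (tvec n (slice True \<phi>)) w\<^sub>1 v\<^sub>1"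
    "0 < r" "r \<le> length T" "normal_node N T n (w\<^sub>0, v\<^sub>0) (w\<^sub>1, v\<^sub>1) (T ! (r - 1))"
proof -
  from b obtain T\<^sub>a w\<^sub>0 v\<^sub>0 T\<^sub>b w\<^sub>1 v\<^sub>1 u where
    ba: "build N n (slice False \<phi>) T\<^sub>0 T\<^sub>a w\<^sub>0 v\<^sub>0" and bb: "build N n (slice True \<phi>) T\<^sub>a T\<^sub>b w\<^sub>1 v\<^sub>1"
    and nrm: "normalize N T\<^sub>b n (w\<^sub>0, v\<^sub>0) (w\<^sub>1, v\<^sub>1) w u" and int: "intern T\<^sub>b u T\<^sub>1 r"
    by (cases rule: build.cases) (use nz in auto)
  note sa = build_sound[OF N ba T(1)]
  then have sa: "good_table T\<^sub>a" "edge_ok N T\<^sub>a n (tvec n (slice False \<phi>)) w\<^sub>0 v\<^sub>0" by auto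
  obtain S' where sb: "good_table T\<^sub>b" "edge_ok N T\<^sub>b n (tvec n (slice True \<phi>)) w\<^sub>1 v\<^sub>1" "T\<^sub>b = T\<^sub>a @ S'"
    using build_sound[OF N bb sa(1)] by blast
  have e0: "edge_ok N T\<^sub>b n (tvec n (slice False \<phi>)) w\<^sub>0 v\<^sub>0"
    unfolding sb(3) by (rule edge_ok_append[OF sa])
  have lh: "low u \<le> length T\<^sub>b" "high u \<le> length T\<^sub>b" using normalize_sound[OF N nrm e0 sb(2)] by auto
  note T1 = intern_good_table[OF sb(1) int lh]
  obtain S'' where S'': "T\<^sub>1 = T\<^sub>b @ S''" using T1(2) by blast
  have Tb: "T = T\<^sub>b @ (S'' @ S)" and Ta: "T = T\<^sub>a @ (S' @ S'' @ S)" using T(2) S'' sb(3) by auto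
  have r: "0 < r" "r \<le> length T" "T ! (r - 1) = u"
    using T1(3-5) T(2) by (auto simp: nth_append)
  have v: "v\<^sub>0 \<le> length T\<^sub>b" "v\<^sub>1 \<le> length T\<^sub>b" using edge_okD(1)[OF e0] edge_okD(1)[OF sb(2)] .
  have nn: "normal_node N T n (w\<^sub>0, v\<^sub>0) (w\<^sub>1, v\<^sub>1) (T ! (r - 1))"
    unfolding r(3) unfolding Tb by (rule normal_node_append[OF sb(1) v normalize_normal_node[OF nrm]])
  have "edge_ok N T n (tvec n (slice False \<phi>)) w\<^sub>0 v\<^sub>0" "edge_ok N T n (tvec n (slice True \<phi>)) w\<^sub>1 v\<^sub>1"
    unfolding Tb using edge_ok_append[OF sb(1)] e0 sb(2) by blast+
  then show ?thesis using that[OF ba bb sa(1) Ta Tb _ _ r(1,2) nn] by blast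
qed

text \<open>Starting tables are arbitrary and only have to end up as prefixes of \<open>T\<close>:
  the slice builds start from different tables, and a low slice may have to be matched with a high
  one.\<close>

lemma build_canonical:
  assumes N: "N \<ge> 1" and T: "good_table T"
  shows "build N n \<phi> T\<^sub>0 T\<^sub>1 w r \<Longrightarrow> build N n \<gamma> T\<^sub>0' T\<^sub>1' w' r' \<Longrightarrow> good_table T\<^sub>0 \<Longrightarrow> good_table T\<^sub>0' \<Longrightarrow>
    T = T\<^sub>1 @ S \<Longrightarrow> T = T\<^sub>1' @ S' \<Longrightarrow> M \<in> weights N n \<Longrightarrow> tvec n \<phi> = M *\<^sub>v tvec n \<gamma> \<Longrightarrow> r = r'"
proof (induction n arbitrary: \<phi> \<gamma> T\<^sub>0 T\<^sub>1 w r T\<^sub>0' T\<^sub>1' w' r' S S' M)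
  case 0
  then show ?case using build_level_0_node by metis
next
  case (Suc n)
  note zero = weights_mult_vec_eq_0_iff[OF N Suc.prems(7) tvec_carrier, of \<gamma>, folded Suc.prems(8)]
  show ?case
  proof (cases "tvec (Suc n) \<phi> = 0\<^sub>v (2 ^ Suc n)")
    case True
    then show ?thesis using zero build_zero_node Suc.prems(1,2) by metis
  next
    case False
    then have False': "tvec (Suc n) \<gamma> \<noteq> 0\<^sub>v (2 ^ Suc n)" using zero by simp
    obtain T\<^sub>a w\<^sub>0 v\<^sub>0 T\<^sub>b w\<^sub>1 v\<^sub>1 S\<^sub>a S\<^sub>b where F:
      "build N n (slice False \<phi>) T\<^sub>0 T\<^sub>a w\<^sub>0 v\<^sub>0" "build N n (slice True \<phi>) T\<^sub>a T\<^sub>b w\<^sub>1 v\<^sub>1"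
      "good_table T\<^sub>a" "T = T\<^sub>a @ S\<^sub>a" "T = T\<^sub>b @ S\<^sub>b"
      "edge_ok N T n (tvec n (slice False \<phi>)) w\<^sub>0 v\<^sub>0" "edge_ok N T n (tvec n (slice True \<phi>)) w\<^sub>1 v\<^sub>1"
      "0 < r" "r \<le> length T" "normal_node N T n (w\<^sub>0, v\<^sub>0) (w\<^sub>1, v\<^sub>1) (T ! (r - 1))"
      by (rule build_Suc_cases[OF N Suc.prems(1) False Suc.prems(3,5)])
    obtain T\<^sub>a' u\<^sub>0 v\<^sub>0' T\<^sub>b' u\<^sub>1 v\<^sub>1' S\<^sub>a' S\<^sub>b' where G:
      "build N n (slice False \<gamma>) T\<^sub>0' T\<^sub>a' u\<^sub>0 v\<^sub>0'" "build N n (slice True \<gamma>) T\<^sub>a' T\<^sub>b' u\<^sub>1 v\<^sub>1'"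
      "good_table T\<^sub>a'" "T = T\<^sub>a' @ S\<^sub>a'" "T = T\<^sub>b' @ S\<^sub>b'"
      "edge_ok N T n (tvec n (slice False \<gamma>)) u\<^sub>0 v\<^sub>0'" "edge_ok N T n (tvec n (slice True \<gamma>)) u\<^sub>1 v\<^sub>1'"
      "0 < r'" "r' \<le> length T" "normal_node N T n (u\<^sub>0, v\<^sub>0') (u\<^sub>1, v\<^sub>1') (T ! (r' - 1))"
      by (rule build_Suc_cases[OF N Suc.prems(2) False' Suc.prems(4,6)])
    obtain b d L where M: "M = kron (phase_mat b d) L" "d \<in> even_phases N" "L \<in> weights N n"
      using Suc.prems(7) by auto
    note dL = weights_smult[OF N M(3) even_phases_nonzero[OF M(2)]]
    have Lc: "L \<in> carrier_mat (2 ^ n) (2 ^ n)" by (rule xp_monomials_carrier[OF M(3)])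
    have sm: "d \<cdot>\<^sub>v (L *\<^sub>v tvec n \<psi>) = (d \<cdot>\<^sub>m L) *\<^sub>v tvec n \<psi>" for \<psi>
      using Lc by (intro smult_mat_mult_vec[symmetric]) simp
    have app: "tvec n (slice False \<phi>) @\<^sub>v tvec n (slice True \<phi>) =
        M *\<^sub>v (tvec n (slice False \<gamma>) @\<^sub>v tvec n (slice True \<gamma>))"
      using Suc.prems(8) by (simp only: tvec_Suc)
    have "T ! (r - 1) = T ! (r' - 1)"
    proof (cases b)
      case False
      have x: "tvec n (slice False \<phi>) = L *\<^sub>v tvec n (slice False \<gamma>)"
        "tvec n (slice True \<phi>) = d \<cdot>\<^sub>v (L *\<^sub>v tvec n (slice True \<gamma>))"
        using app False mat_vec_carrier[OF Lc]
        by (simp_all add: M(1) kron_phase_mat_vec[OF Lc] append_vec_eq[of _ "2 ^ n"])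
      have "v\<^sub>0 = v\<^sub>0'" using Suc.IH[OF F(1) G(1) Suc.prems(3,4) F(4) G(4) M(3) x(1)] .
      moreover have "v\<^sub>1 = v\<^sub>1'"
        using Suc.IH[OF F(2) G(2) F(3) G(3) F(5) G(5) dL] x(2) sm by simp
      ultimately show ?thesis
        using normal_node_unique[OF N M(3,2) F(6,7) _ _ x F(10)] G(6,7,10) by simp
    next
      \<comment> \<open>X on the top index matches low slices with high slices, so the induction
        hypothesis is used across.\<close>
      case True
      have x: "tvec n (slice False \<phi>) = d \<cdot>\<^sub>v (L *\<^sub>v tvec n (slice True \<gamma>))"
        "tvec n (slice True \<phi>) = L *\<^sub>v tvec n (slice False \<gamma>)"
        using app True mat_vec_carrier[OF Lc]
        by (simp_all add: M(1) kron_phase_mat_vec[OF Lc] append_vec_eq[of _ "2 ^ n"])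
      have "v\<^sub>0 = v\<^sub>1'"
        using Suc.IH[OF F(1) G(2) Suc.prems(3) G(3) F(4) G(5) dL] x(1) sm by simp
      moreover have "v\<^sub>1 = v\<^sub>0'" using Suc.IH[OF F(2) G(1) F(3) Suc.prems(4) F(5) G(4) M(3) x(2)] .
      moreover have "u\<^sub>0 \<noteq> 0\<^sub>m (2 ^ n) (2 ^ n) \<or> u\<^sub>1 \<noteq> 0\<^sub>m (2 ^ n) (2 ^ n)"
      proof (rule ccontr)
        assume "\<not> ?thesis"
        then have "tvec n (slice False \<gamma>) = 0\<^sub>v (2 ^ n)" "tvec n (slice True \<gamma>) = 0\<^sub>v (2 ^ n)"
          using edge_ok_zero_iff[OF N G(6)] edge_ok_zero_iff[OF N G(7)] by auto
        then have "tvec (Suc n) \<gamma> = 0\<^sub>v (2 ^ Suc n)" unfolding tvec_Suc by (intro eq_vecI) auto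
        then show False using False' by simp
      qed
      from normal_node_swap[OF G(10) this]
      have "normal_node N T n (u\<^sub>1, v\<^sub>1') (u\<^sub>0, v\<^sub>0') (T ! (r' - 1))" .
      \<comment> \<open>Now the low slice of \<phi> carries \<open>d\<close> times \<open>L\<close>;
        relative to this operator the high slice has the inverse phase.\<close>
      moreover have "tvec n (slice True \<phi>) = inverse d \<cdot>\<^sub>v ((d \<cdot>\<^sub>m L) *\<^sub>v tvec n (slice False \<gamma>))"
        unfolding x(2) sm[symmetric] using even_phases_nonzero[OF M(2)] by (simp add: smult_smult_assoc)
      ultimately show ?thesis
        using normal_node_unique[OF N dL even_phases_inverse[OF N M(2)] F(6,7) _ _ _ _ F(10)] G(6,7) x(1) sm
        by simp
    qed
    then show ?thesis using good_table_nth_inject[OF T F(8,9) G(8,9)] by blast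
  qed
qed

lemma limtdd_rep_sound:
  assumes N: "N \<ge> 1" and "limtdd_rep N T n \<phi> w r"
  obtains T\<^sub>0 T\<^sub>1 S where "good_table T\<^sub>0" "build N n \<phi> T\<^sub>0 T\<^sub>1 w r" "T = T\<^sub>1 @ S" "good_table T"
    "edge_ok N T n (tvec n \<phi>) w r"
proof -
  obtain T\<^sub>0 T\<^sub>1 where h: "(table_step N)\<^sup>*\<^sup>* [] T\<^sub>0" "build N n \<phi> T\<^sub>0 T\<^sub>1 w r" "(table_step N)\<^sup>*\<^sup>* T\<^sub>1 T"
    using assms(2) by (auto simp: limtdd_rep_def)
  have T0: "good_table T\<^sub>0" using table_step_good[OF N h(1)] by (simp add: good_table_def)
  have T1: "good_table T\<^sub>1" "edge_ok N T\<^sub>1 n (tvec n \<phi>) w r" using build_sound[OF N h(2) T0] by auto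
  obtain S where S: "good_table T" "T = T\<^sub>1 @ S" using table_step_good[OF N h(3) T1(1)] by blast
  have "edge_ok N T n (tvec n \<phi>) w r" unfolding S(2) by (rule edge_ok_append[OF T1])
  then show ?thesis using that[OF T0 h(2) S(2,1)] by blast
qed

theorem theorem1:
  fixes N n :: nat and T :: table and \<phi> \<gamma> :: tensor
    and w\<^sub>F w\<^sub>G :: "complex mat" and r\<^sub>F r\<^sub>G :: nat
  assumes "N \<ge> 1"
    and "limtdd_rep N T n \<phi> w\<^sub>F r\<^sub>F"
    and "limtdd_rep N T n \<gamma> w\<^sub>G r\<^sub>G"
  shows "xp_isomorphic N n \<phi> \<gamma> \<longleftrightarrow>
    r\<^sub>F = r\<^sub>G \<and>
    (\<exists>c A g. c \<noteq> 0 \<and> A \<in> xp_group N n \<and> g \<in> stab N T n r\<^sub>G \<and> w\<^sub>F = c \<cdot>\<^sub>m (A * w\<^sub>G * g))"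
    (is "?L \<longleftrightarrow> ?R")
proof
  note N = assms(1)
  obtain T\<^sub>0 T\<^sub>1 S where F: "good_table T\<^sub>0" "build N n \<phi> T\<^sub>0 T\<^sub>1 w\<^sub>F r\<^sub>F" "T = T\<^sub>1 @ S" "good_table T"
    "edge_ok N T n (tvec n \<phi>) w\<^sub>F r\<^sub>F" by (rule limtdd_rep_sound[OF N assms(2)])
  obtain T\<^sub>0' T\<^sub>1' S' where G: "good_table T\<^sub>0'" "build N n \<gamma> T\<^sub>0' T\<^sub>1' w\<^sub>G r\<^sub>G" "T = T\<^sub>1' @ S'" "good_table T"
    "edge_ok N T n (tvec n \<gamma>) w\<^sub>G r\<^sub>G" by (rule limtdd_rep_sound[OF N assms(3)])
  have vecs: "tvec n \<phi> = w\<^sub>F *\<^sub>v node_vec T n r\<^sub>F" "tvec n \<gamma> = w\<^sub>G *\<^sub>v node_vec T n r\<^sub>G"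
    using edge_okD(2)[OF F(5)] edge_okD(2)[OF G(5)] .
  have wG: "w\<^sub>G \<in> carrier_mat (2 ^ n) (2 ^ n)"
    using edge_okD(3,4)[OF G(5)] xp_monomials_carrier zero_carrier_mat by metis
  note pc = mult_carrier_mat[of _ "2 ^ n" "2 ^ n" _ "2 ^ n"]
  have act: "(c \<cdot>\<^sub>m A) *\<^sub>v tvec n \<gamma> = c \<cdot>\<^sub>v (A *\<^sub>v tvec n \<gamma>)" if "A \<in> xp_group N n" for c A
  proof -
    have "A \<in> carrier_mat (2 ^ n) (2 ^ n)" using that xp_monomials_carrier by (auto simp: xp_group_eq[OF N])
    then show ?thesis by (intro smult_mat_mult_vec) simp
  qed
  {
    assume ?L
    then obtain c A where c: "c \<noteq> 0" and A: "A \<in> xp_group N n" and eq: "tvec n \<phi> = c \<cdot>\<^sub>v (A *\<^sub>v tvec n \<gamma>)"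
      by (auto simp: xp_isomorphic_def)
    have M: "c \<cdot>\<^sub>m A \<in> weights N n" using weights_memI[OF N c] A by (simp add: xp_group_eq[OF N])
    have Ac: "A \<in> carrier_mat (2 ^ n) (2 ^ n)" using A xp_monomials_carrier by (auto simp: xp_group_eq[OF N])
    have eq': "tvec n \<phi> = (c \<cdot>\<^sub>m A) *\<^sub>v tvec n \<gamma>" using eq act[OF A] by simp
    have r: "r\<^sub>F = r\<^sub>G" by (rule build_canonical[OF N F(4) F(2) G(2) F(1) G(1) F(3) G(3) M eq'])
    have "\<exists>g \<in> stab N T n r\<^sub>G. w\<^sub>F = c \<cdot>\<^sub>m (A * w\<^sub>G * g)"
    proof (cases "w\<^sub>G = 0\<^sub>m (2 ^ n) (2 ^ n)")
      \<comment> \<open>Here \<open>w\<^sub>G\<close> has no inverse to form a quotient with, but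
        both root weights are zero and the identity serves as g.\<close>
      case True
      then have "tvec n \<phi> = 0\<^sub>v (2 ^ n)"
        using True edge_ok_zero_iff[OF N G(5)] weights_mult_vec_eq_0_iff[OF N M tvec_carrier] eq' by metis
      then have "w\<^sub>F = 0\<^sub>m (2 ^ n) (2 ^ n)" using edge_ok_zero_iff[OF N F(5)] by simp
      then have "w\<^sub>F = c \<cdot>\<^sub>m (A * w\<^sub>G * 1\<^sub>m (2 ^ n))" using True Ac by simp
      then show ?thesis using stab_one[OF N] by blast
    next
      case False
      note w = edge_ok_weight[OF N G(5) False]
      have "tvec n \<phi> \<noteq> 0\<^sub>v (2 ^ n)"
        using False edge_ok_zero_iff[OF N G(5)] weights_mult_vec_eq_0_iff[OF N M tvec_carrier] eq' by simp
      then have wF: "w\<^sub>F \<in> weights N n" by (rule edge_okD(4)[OF F(5)])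
      have "w\<^sub>F *\<^sub>v node_vec T n r\<^sub>G = (c \<cdot>\<^sub>m A * w\<^sub>G) *\<^sub>v node_vec T n r\<^sub>G"
        using vecs r eq' assoc_mult_mat_vec[OF xp_monomials_carrier[OF M] wG tvec_carrier] by simp
      then obtain s where s: "s \<in> stab N T n r\<^sub>G" "w\<^sub>F = c \<cdot>\<^sub>m A * w\<^sub>G * s"
        using weights_factor_stab[OF N wF weights_mult[OF N M w(1)] w(2)] by blast
      have "s \<in> carrier_mat (2 ^ n) (2 ^ n)" using stab_weights[OF N s(1)] xp_monomials_carrier by blast
      then have "w\<^sub>F = c \<cdot>\<^sub>m (A * w\<^sub>G * s)"
        using s(2) Ac wG pc by (simp add: mult_smult_assoc_mat[of _ "2 ^ n" "2 ^ n" _ "2 ^ n"])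
      then show ?thesis using s(1) by blast
    qed
    then show ?R using r c A by blast
  }
  {
    \<comment> \<open>The element g fixes the root tensor and disappears, leaving c A applied to the
      tensor of \<open>w\<^sub>G\<close>, which is \<gamma>.\<close>
    assume ?R
    then obtain c A g where r: "r\<^sub>F = r\<^sub>G" and c: "c \<noteq> 0" and A: "A \<in> xp_group N n"
      and g: "g \<in> stab N T n r\<^sub>G" and w: "w\<^sub>F = c \<cdot>\<^sub>m (A * w\<^sub>G * g)" by blast
    have Ac: "A \<in> carrier_mat (2 ^ n) (2 ^ n)" using A xp_monomials_carrier by (auto simp: xp_group_eq[OF N])
    have gc: "g \<in> carrier_mat (2 ^ n) (2 ^ n)" using stab_weights[OF N g] xp_monomials_carrier by blast
    have AG: "A * w\<^sub>G \<in> carrier_mat (2 ^ n) (2 ^ n)" using Ac wG by (rule pc)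
    have "tvec n \<phi> = c \<cdot>\<^sub>v ((A * w\<^sub>G * g) *\<^sub>v node_vec T n r\<^sub>G)"
      unfolding vecs(1) w r using gc by (intro smult_mat_mult_vec) simp
    also have "(A * w\<^sub>G * g) *\<^sub>v node_vec T n r\<^sub>G = A *\<^sub>v tvec n \<gamma>"
      unfolding vecs(2) assoc_mult_mat_vec[OF AG gc tvec_carrier] stab_fixes[OF N g]
      by (rule assoc_mult_mat_vec[OF Ac wG tvec_carrier])
    finally show ?L using c A by (auto simp: xp_isomorphic_def)
  }
qed

end
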